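(* Let $\alpha,b,x_1,\dots,x_n,a_1,\dots,a_n$ be complex parameters such that no denominator in the identity below vanishes. Let $f(y_1,\dots,y_n)$ be a complex function of $n$ variables (defined at all points where it is evaluated below). Assume that either (i) $f$ is such that both sides of the identity are analytic in $a_1,\dots,a_n$ and the series converges absolutely for each $a_r$ in a disk around the origin, and each $a_r$ lies in this disk; or (ii) $a_r=q^{N_r}$ with $N_r$ a positive integer for $r=1,\dots,n$ (so that the series terminates). Then $$\begin{aligned} & f(\alpha a_{1},\dots,\alpha a_{n})\frac{(\alpha q)_{\infty}}{(\alpha a_{1}\cdots a_{n}q^{1-n})_{\infty}}\prod_{r=1}^{n}\frac{(\alpha a_{r}bx_{r}/q)_{\infty}}{(\alpha bx_{r})_{\infty}}\\ &=\sum_{k_1,\dots,k_n\ge0}\ \prod_{1\leq r<s\leq n}\frac{1-q^{k_{r}-k_{s}}x_{r}/x_{s}}{1-x_{r}/x_{s}}\prod_{r,s=1}^{n}\frac{(qx_{r}/(x_{s}a_{s}))_{k_{r}}}{(qx_{r}/x_{s})_{k_{r}}}\\ &\quad\times\frac{(1-\alpha q^{2|\boldsymbol{k}|})(\alpha)_{|\boldsymbol{k}|}}{(1-\alpha)(\alpha a_{1}\cdots a_{n}q^{1-n})_{|\boldsymbol{k}|}}(a_{1}\cdots a_{n})^{|\boldsymbol{k}|}q^{\sum_{r=1}^{n}(r-1)k_{r}-n|\boldsymbol{k}|}\\ &\quad\times\sum_{\substack{0\leq m_{r}\leq k_{r}\\ r=1,\dots,n}}\ \prod_{1\leq r<s\leq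 n}\frac{1-q^{m_{r}-m_{s}}x_{r}/x_{s}}{1-x_{r}/x_{s}}\prod_{r,s=1}^{n}\frac{(q^{-k_{s}}x_{r}/x_{s})_{m_{r}}}{(qx_{r}/x_{s})_{m_{r}}}\cdot\frac{(\alpha q^{|\boldsymbol{k}|})_{|\boldsymbol{m}|}}{\prod_{r=1}^{n}(\alpha bx_{r})_{m_{r}}}q^{\sum_{r=1}^{n}rm_{r}}f(\alpha q^{1+m_{1}},\dots,\alpha q^{1+m_{n}}). \end{aligned}$$
   Context: $q$ is a complex number with $0<|q|<1$ and $n\ge1$ is an integer. $(z)_\infty=\prod_{i\ge0}(1-zq^i)$ and $(z)_k=(z)_\infty/(zq^k)_\infty=\prod_{i=0}^{k-1}(1-zq^i)$. Bold letters denote multi-indices of nonnegative integers, $\boldsymbol k=(k_1,\dots,k_n)$, with $|\boldsymbol k|=k_1+\cdots+k_n$. If some $a_s=0$, the expression $\prod_{r,s}(qx_r/(x_sa_s))_{k_r}(a_1\cdots a_n)^{|\boldsymbol k|}$, which is polynomial in the $a_s$, is understood by continuity. *)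

theory Defs
  imports "HOL-Analysis.Analysis"
begin

definition qpoch :: "complex \<Rightarrow> complex \<Rightarrow> nat \<Rightarrow> complex" where
  "qpoch q z k = (\<Prod>i<k. 1 - z * q ^ i)"

definition qpoch_inf :: "complex \<Rightarrow> complex \<Rightarrow> complex" where
  "qpoch_inf q z = (\<Prod>i. 1 - z * q ^ i)"

text \<open>
  Tuples indexed by \<open>1, \<dots>, n\<close> are functions on \<open>nat\<close> that are \<open>undefined\<close> outside \<open>{1..n}\<close>,
  so that a function of \<open>n\<close> variables is a function on such tuples.
\<close>

definition multi_indices :: "nat \<Rightarrow> (nat \<Rightarrow> nat) set" where
  "multi_indices n = ({1..n} \<rightarrow>\<^sub>E UNIV)"

definition msize :: "nat \<Rightarrow> (nat \<Rightarrow> nat) \<Rightarrow> nat" where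
  "msize n k = (\<Sum>r=1..n. k r)"

definition polydisc :: "nat \<Rightarrow> (nat \<Rightarrow> complex) \<Rightarrow> (nat \<Rightarrow> real) \<Rightarrow> (nat \<Rightarrow> complex) set" where
  "polydisc n p \<rho> = (\<Pi>\<^sub>E r\<in>{1..n}. ball (p r) (\<rho> r))"

text \<open>
  Analyticity in \<open>n\<close> complex variables: around every point of \<open>U\<close> the function is the sum of a
  convergent multiple power series (unordered, hence absolute, convergence).
\<close>

definition multi_analytic_on ::
  "nat \<Rightarrow> ((nat \<Rightarrow> complex) \<Rightarrow> complex) \<Rightarrow> (nat \<Rightarrow> complex) set \<Rightarrow> bool" where
  "multi_analytic_on n g U \<longleftrightarrow>
     (\<forall>p\<in>U. \<exists>c. \<exists>\<epsilon>>0. \<forall>z\<in>polydisc n p (\<lambda>_. \<epsilon>).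
        ((\<lambda>\<nu>. c \<nu> * (\<Prod>r=1..n. (z r - p r) ^ \<nu> r)) has_sum g z) (multi_indices n))"

definition vandermonde_quot :: "nat \<Rightarrow> complex \<Rightarrow> (nat \<Rightarrow> complex) \<Rightarrow> (nat \<Rightarrow> nat) \<Rightarrow> complex" where
  "vandermonde_quot n q x k =
     (\<Prod>r=1..n. \<Prod>s\<in>{r<..n}.
        (1 - q powi (int (k r) - int (k s)) * (x r / x s)) / (1 - x r / x s))"

text \<open>
  The polynomial in \<open>a\<^sub>1, \<dots>, a\<^sub>n\<close> that continues
  \<open>\<Prod>\<^sub>r\<^sub>,\<^sub>s (q x\<^sub>r / (x\<^sub>s a\<^sub>s))\<^bsub>k\<^sub>r\<^esub> \<cdot> (a\<^sub>1 \<cdots> a\<^sub>n)\<^bsup>|k|\<^esup>\<close> to points where some \<open>a\<^sub>s\<close> is \<open>0\<close>; it is obtained by moving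
  one factor \<open>a\<^sub>s\<close> into each \<open>1 - q\<^bsup>i+1\<^esup> x\<^sub>r / (x\<^sub>s a\<^sub>s)\<close>. The two lemmas below justify it.
\<close>

definition num_poly ::
  "nat \<Rightarrow> complex \<Rightarrow> (nat \<Rightarrow> complex) \<Rightarrow> (nat \<Rightarrow> complex) \<Rightarrow> (nat \<Rightarrow> nat) \<Rightarrow> complex" where
  "num_poly n q x a k =
     (\<Prod>r=1..n. \<Prod>s=1..n. \<Prod>i<k r. a s - q * x r / x s * q ^ i)"

lemma num_poly_eq:
  assumes "\<And>s. s \<in> {1..n} \<Longrightarrow> a s \<noteq> 0"
  shows "num_poly n q x a k =
           (\<Prod>r=1..n. \<Prod>s=1..n. qpoch q (q * x r / (x s * a s)) (k r)) *
           (\<Prod>s=1..n. a s) ^ msize n k"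
proof -
  have "num_poly n q x a k =
      (\<Prod>r=1..n. \<Prod>s=1..n. qpoch q (q * x r / (x s * a s)) (k r) * a s ^ k r)"
    unfolding num_poly_def
  proof (intro prod.cong refl)
    fix r s assume "s \<in> {1..n}"
    then have "a s \<noteq> 0" using assms by blast
    then have "a s - q * x r / x s * q ^ i = (1 - q * x r / (x s * a s) * q ^ i) * a s" for i
      by (cases "x s = 0") (auto simp: field_simps)
    then show "(\<Prod>i<k r. a s - q * x r / x s * q ^ i) =
        qpoch q (q * x r / (x s * a s)) (k r) * a s ^ k r"
      by (simp add: qpoch_def prod.distrib)
  qed
  also have "\<dots> = (\<Prod>r=1..n. \<Prod>s=1..n. qpoch q (q * x r / (x s * a s)) (k r)) *
      (\<Prod>r=1..n. (\<Prod>s=1..n. a s) ^ k r)"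
    by (simp add: prod.distrib prod_power_distrib)
  finally show ?thesis
    by (simp add: msize_def power_sum)
qed

lemma continuous_on_num_poly: "continuous_on UNIV (\<lambda>a. num_poly n q x a k)"
  unfolding num_poly_def
  by (intro continuous_intros continuous_on_product_coordinates)

definition lhs ::
  "nat \<Rightarrow> complex \<Rightarrow> complex \<Rightarrow> complex \<Rightarrow> (nat \<Rightarrow> complex) \<Rightarrow>
   ((nat \<Rightarrow> complex) \<Rightarrow> complex) \<Rightarrow> (nat \<Rightarrow> complex) \<Rightarrow> complex" where
  "lhs n q \<alpha> b x f a =
     f (\<lambda>r\<in>{1..n}. \<alpha> * a r) *
     (qpoch_inf q (\<alpha> * q) / qpoch_inf q (\<alpha> * (\<Prod>r=1..n. a r) * q powi (1 - int n))) *
     (\<Prod>r=1..n. qpoch_inf q (\<alpha> * a r * b * x r / q) / qpoch_inf q (\<alpha> * b * x r))"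

definition inner_sum ::
  "nat \<Rightarrow> complex \<Rightarrow> complex \<Rightarrow> complex \<Rightarrow> (nat \<Rightarrow> complex) \<Rightarrow>
   ((nat \<Rightarrow> complex) \<Rightarrow> complex) \<Rightarrow> (nat \<Rightarrow> nat) \<Rightarrow> complex" where
  "inner_sum n q \<alpha> b x f k =
     (\<Sum>m\<in>(\<Pi>\<^sub>E r\<in>{1..n}. {0..k r}).
        vandermonde_quot n q x m *
        (\<Prod>r=1..n. \<Prod>s=1..n.
           qpoch q (q powi (- int (k s)) * x r / x s) (m r) / qpoch q (q * x r / x s) (m r)) *
        (qpoch q (\<alpha> * q ^ msize n k) (msize n m) / (\<Prod>r=1..n. qpoch q (\<alpha> * b * x r) (m r))) *
        q ^ (\<Sum>r=1..n. r * m r) *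
        f (\<lambda>r\<in>{1..n}. \<alpha> * q ^ (1 + m r)))"

definition rhs_term ::
  "nat \<Rightarrow> complex \<Rightarrow> complex \<Rightarrow> complex \<Rightarrow> (nat \<Rightarrow> complex) \<Rightarrow>
   ((nat \<Rightarrow> complex) \<Rightarrow> complex) \<Rightarrow> (nat \<Rightarrow> complex) \<Rightarrow> (nat \<Rightarrow> nat) \<Rightarrow> complex" where
  "rhs_term n q \<alpha> b x f a k =
     vandermonde_quot n q x k *
     (num_poly n q x a k / (\<Prod>r=1..n. \<Prod>s=1..n. qpoch q (q * x r / x s) (k r))) *
     ((1 - \<alpha> * q ^ (2 * msize n k)) * qpoch q \<alpha> (msize n k) /
      ((1 - \<alpha>) * qpoch q (\<alpha> * (\<Prod>r=1..n. a r) * q powi (1 - int n)) (msize n k))) *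
     q powi ((\<Sum>r=1..n. (int r - 1) * int (k r)) - int n * int (msize n k)) *
     inner_sum n q \<alpha> b x f k"

end

theory Submission
  imports Defs "HOL-Complex_Analysis.Complex_Analysis"
begin

text \<open>
  In the terminating case \<open>a\<^sub>r = q\<^bsup>M\<^sub>r + 1\<^esup>\<close> compare the coefficients of \<open>f (\<alpha> q\<^bsup>1 + m\<^sub>1\<^esup>, \<dots>, \<alpha> q\<^bsup>1 + m\<^sub>n\<^esup>)\<close>. For fixed
  \<open>m\<close>, the summand of the outer sum depends on \<open>k\<close> through \<open>|k|\<close> and a multivariate factor \<open>T\<^sub>k\<close>. With
  \<open>z\<^sub>r = x\<^sub>r q\<^bsup>k\<^sub>r\<^esup>\<close>, the partial fraction expansions of \<open>\<Prod>\<^sub>s (z - x\<^sub>s q\<^bsup>m\<^sub>s\<^esup>) / (z \<Prod>\<^sub>s (z - z\<^sub>s))\<close> and of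
  \<open>\<Prod>\<^sub>s (q z - a\<^sub>s x\<^sub>s) / (z \<Prod>\<^sub>s (z - z\<^sub>s))\<close> turn the quotients \<open>T\<^bsub>k + e\<^sub>r\<^esub> / T\<^sub>k\<close> into a two-term recurrence in \<open>N\<close> for
  \<open>\<Sum>\<^bsub>|k| = N\<^esub> T\<^sub>k\<close>. This reduces the coefficient to a one-variable sum, which telescopes to \<open>0\<close> unless \<open>m = M\<close>;
  the remaining diagonal term is evaluated by the same kind of quotient.

  In the analytic case both sides agree at all points \<open>(q\<^bsup>N\<^sub>1\<^esup>, \<dots>, q\<^bsup>N\<^sub>n\<^esup>)\<close> with large \<open>N\<^sub>r\<close>. These accumulate at the
  origin in each variable separately, so the identity theorem, applied to one variable at a time, gives
  equality on the whole polydisc.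
\<close>

section \<open>Partial fractions and Vandermonde products\<close>

text \<open>The old factor stands on the left instead of being divided by on the right, so it may be
  zero.\<close>

lemma prod_fun_upd:
  fixes g :: "'a \<Rightarrow> 'b \<Rightarrow> 'c::comm_monoid_mult"
  assumes "finite I" "r \<in> I"
  shows "(\<Prod>s\<in>I. g s ((k(r := v)) s)) * g r (k r) = (\<Prod>s\<in>I. g s (k s)) * g r v"
proof -
  have "(\<Prod>s\<in>I - {r}. g s ((k(r := v)) s)) = (\<Prod>s\<in>I - {r}. g s (k s))"
    by (rule prod.cong) auto
  then show ?thesis
    by (simp add: prod.remove[OF assms] mult_ac)
qed

lemma sum_fun_upd_Suc:
  fixes k :: "'a \<Rightarrow> nat"
  assumes "finite I" "r \<in> I"
  shows "(\<Sum>s\<in>I. (k(r := Suc (k r))) s) = Suc (\<Sum>s\<in>I. k s)"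
proof -
  have "(\<Sum>s\<in>I - {r}. (k(r := Suc (k r))) s) = (\<Sum>s\<in>I - {r}. k s)"
    by (rule sum.cong) auto
  then show ?thesis
    by (simp add: sum.remove[OF assms])
qed

lemma prod_neg_minus:
  fixes u v :: "'a \<Rightarrow> 'b::comm_ring_1"
  shows "(\<Prod>s\<in>I. u s - v s) = (-1) ^ card I * (\<Prod>s\<in>I. v s - u s)"
proof -
  have "(\<Prod>s\<in>I. u s - v s) = (\<Prod>s\<in>I. - 1 * (v s - u s))"
    by (rule prod.cong) auto
  then show ?thesis
    by (simp only: prod.distrib prod_constant)
qed

text \<open>As the degree of \<open>p\<close> is below \<open>card A\<close>, \<open>p\<close>
  equals its Lagrange interpolant on \<open>A\<close>. Each basis polynomial \<open>L a\<close> is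
  monic of degree \<open>card A - 1\<close>, so comparing the coefficients in that degree gives the
  claim.\<close>

lemma sum_Lagrange_lead_coeff:
  fixes p :: "'a::field poly"
  assumes "finite A" "degree p < card A"
  shows "(\<Sum>a\<in>A. poly p a / (\<Prod>b\<in>A - {a}. a - b)) = coeff p (card A - 1)"
proof -
  define L where "L a = (\<Prod>b\<in>A - {a}. [:-b, 1:])" for a
  define w where "w a = (\<Prod>b\<in>A - {a}. a - b)" for a
  define P where "P = (\<Sum>a\<in>A. smult (poly p a / w a) (L a))"
  have w: "w a \<noteq> 0" if "a \<in> A" for a
    using assms(1) unfolding w_def by auto
  have degL: "degree (L a) = card A - 1" if "a \<in> A" for a
    using assms(1) that unfolding L_def by (subst degree_prod_eq_sum_degree) auto
  have lcL: "coeff (L a) (card A - 1) = 1" if "a \<in> A" for a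
  proof -
    have "lead_coeff (L a) = 1"
      unfolding L_def by (simp add: lead_coeff_prod)
    then show ?thesis using degL[OF that] by simp
  qed
  have polyL: "poly (L a) c = (if c = a then w a else 0)" if "c \<in> A" "a \<in> A" for a c
    using that assms(1) by (auto simp: L_def w_def poly_prod)
  have "p = P"
  proof (rule poly_eqI_degree)
    fix c assume c: "c \<in> A"
    have "poly P c = (\<Sum>a\<in>A. if c = a then poly p c else 0)"
      unfolding P_def poly_sum using c w by (intro sum.cong) (auto simp: polyL)
    then show "poly p c = poly P c" using c assms(1) by simp
  next
    have "degree P \<le> card A - 1"
      unfolding P_def using degL
      by (intro degree_sum_le assms) (metis degree_smult_le)
    then show "card A > degree P" using assms(2) by linarith
  qed fact
  then have "coeff p (card A - 1) = coeff P (card A - 1)" by simp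
  also have "\<dots> = (\<Sum>a\<in>A. poly p a / w a)"
    unfolding P_def coeff_sum by (rule sum.cong) (simp_all add: lcL del: One_nat_def)
  finally show ?thesis by (simp add: w_def)
qed

text \<open>Some \<open>c s\<close> may vanish, so \<open>card I\<close> only bounds the degree, and
  the coefficient in this fixed position replaces the leading coefficient.\<close>

lemma coeff_prod_linear_card:
  fixes b c :: "'a \<Rightarrow> 'b::comm_semiring_1"
  assumes "finite I"
  shows "degree (\<Prod>s\<in>I. [:b s, c s:]) \<le> card I \<and> coeff (\<Prod>s\<in>I. [:b s, c s:]) (card I) = (\<Prod>s\<in>I. c s)"
  using assms
proof (induction I rule: finite_induct)
  case (insert i I)
  let ?p = "\<Prod>s\<in>I. [:b s, c s:]"
  have "degree ([:b i, c i:] * ?p) \<le> degree [:b i, c i:] + degree ?p" by (rule degree_mult_le)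
  also have "\<dots> \<le> Suc (card I)" using insert.IH degree_pCons_le[of "b i" "[:c i:]"] by simp
  finally have 1: "degree ([:b i, c i:] * ?p) \<le> Suc (card I)" .
  have "coeff ?p (Suc (card I)) = 0"
    using insert.IH by (intro coeff_eq_0) auto
  then have "coeff ([:b i, c i:] * ?p) (Suc (card I)) = c i * (\<Prod>s\<in>I. c s)"
    using insert.IH by simp
  then show ?case using insert.hyps 1 by simp
qed simp

text \<open>Interpolate the polynomial with values \<Prod>(c_s t - b_s) at the nodes z_r and the
  extra node 0. The extra node makes the number of nodes exceed the degree, and its summand is the
  quotient of the products of \<open>b\<close> and \<open>z\<close>.\<close>

lemma partial_fractions_sum:
  fixes z b c :: "'i \<Rightarrow> 'a::field"
  assumes "finite I" "inj_on z I" "\<And>r. r \<in> I \<Longrightarrow> z r \<noteq> 0"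
  shows "(\<Sum>r\<in>I. (\<Prod>s\<in>I. c s * z r - b s) / (z r * (\<Prod>s\<in>I - {r}. z r - z s))) =
         (\<Prod>s\<in>I. c s) - (\<Prod>s\<in>I. b s) / (\<Prod>s\<in>I. z s)"
proof -
  define p where "p = (\<Prod>s\<in>I. [:- b s, c s:])"
  define A where "A = insert 0 (z ` I)"
  have z0: "0 \<notin> z ` I" using assms(3) by auto
  have cA: "card A = Suc (card I)"
    unfolding A_def using z0 assms(1,2) by (simp add: card_image)
  have pp: "poly p t = (\<Prod>s\<in>I. c s * t - b s)" for t
    unfolding p_def poly_prod by (rule prod.cong) (auto simp: algebra_simps)
  have cp: "degree p \<le> card I" "coeff p (card I) = (\<Prod>s\<in>I. c s)"
    using coeff_prod_linear_card[OF assms(1), of "\<lambda>s. - b s" c] by (auto simp: p_def)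
  have "(\<Sum>a\<in>A. poly p a / (\<Prod>b\<in>A - {a}. a - b)) = (\<Prod>s\<in>I. c s)"
    using sum_Lagrange_lead_coeff[of A p] cA cp assms(1) by (simp add: A_def)
  moreover have "(\<Sum>a\<in>A. poly p a / (\<Prod>b\<in>A - {a}. a - b)) =
      poly p 0 / (\<Prod>b\<in>z ` I. - b) + (\<Sum>r\<in>I. poly p (z r) / (\<Prod>b\<in>A - {z r}. z r - b))"
    unfolding A_def using z0 assms(1,2) by (simp add: sum.reindex)
  moreover have "(\<Prod>b\<in>A - {z r}. z r - b) = z r * (\<Prod>s\<in>I - {r}. z r - z s)" if "r \<in> I" for r
  proof -
    have "A - {z r} = insert 0 (z ` (I - {r}))"
      unfolding A_def using that z0 assms(2) by (auto simp: inj_on_def)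
    moreover have "inj_on z (I - {r})" "0 \<notin> z ` (I - {r})"
      using assms(2) z0 by (auto simp: inj_on_def)
    ultimately show ?thesis using assms(1) by (simp add: prod.reindex)
  qed
  \<comment> \<open>Numerator and denominator carry the same sign \<open>(-1) ^ card I\<close>,
    which cancels.\<close>
  moreover have "poly p 0 / (\<Prod>b\<in>z ` I. - b) = (\<Prod>s\<in>I. b s) / (\<Prod>s\<in>I. z s)"
  proof -
    have "(\<Prod>s\<in>I. - b s) = (-1) ^ card I * (\<Prod>s\<in>I. b s)"
      and "(\<Prod>s\<in>I. - z s) = (-1) ^ card I * (\<Prod>s\<in>I. z s)"
      using prod_neg_minus[of "\<lambda>_. 0" b I] prod_neg_minus[of "\<lambda>_. 0" z I] by simp_all
    then show ?thesis
      using assms(2) by (simp add: pp prod.reindex)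
  qed
  ultimately show ?thesis
    by (simp add: pp eq_diff_eq add.commute)
qed

definition vandermonde :: "nat \<Rightarrow> (nat \<Rightarrow> complex) \<Rightarrow> complex" where
  "vandermonde n z = (\<Prod>r=1..n. \<Prod>s\<in>{r<..n}. z r - z s)"

text \<open>As a function of its \<open>r\<close>-th entry \<open>v\<close>, the Vandermonde product
  is a constant \<open>C\<close> times \<Prod>(v - z_s) over s \<noteq> r. Evaluate this at
  \<open>w\<close> and at \<open>z r\<close> and eliminate \<open>C\<close> by cross-multiplication,
  which allows coinciding entries.\<close>

lemma vandermonde_fun_upd:
  assumes r: "r \<in> {1..n}"
  shows "vandermonde n (z(r := w)) * (\<Prod>s\<in>{1..n} - {r}. z r - z s) =
         vandermonde n z * (\<Prod>s\<in>{1..n} - {r}. w - z s)"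
proof -
  define P where "P = {(i, j). i \<in> {1..n} \<and> j \<in> {1..n} \<and> i < j \<and> i \<noteq> r \<and> j \<noteq> r}"
  define C where "C = (-1) ^ (r - 1) * (\<Prod>(i, j)\<in>P. z i - z j)"
  have "vandermonde n (z(r := v)) = C * (\<Prod>s\<in>{1..n} - {r}. v - z s)" for v
  proof -
    let ?z = "z(r := v)"
    let ?Q = "{(i, j). i \<in> {1..n} \<and> j \<in> {1..n} \<and> i < j}"
    have fin: "finite P" unfolding P_def by (rule finite_subset[of _ "{1..n} \<times> {1..n}"]) auto
    have "vandermonde n ?z = (\<Prod>(i, j)\<in>(SIGMA i:{1..n}. {i<..n}). ?z i - ?z j)"
      unfolding vandermonde_def by (subst prod.Sigma) auto
    also have "(SIGMA i:{1..n}. {i<..n}) = P \<union> Pair r ` {r<..n} \<union> (\<lambda>s. (s, r)) ` {1..<r}"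
      unfolding P_def using r by auto
    also have "(\<Prod>(i, j)\<in>\<dots>. ?z i - ?z j) =
      (\<Prod>(i, j)\<in>P. ?z i - ?z j) * (\<Prod>s\<in>{r<..n}. ?z r - ?z s) * (\<Prod>s\<in>{1..<r}. ?z s - ?z r)"
    proof -
      have inj: "inj_on (Pair r) {r<..n}" "inj_on (\<lambda>s. (s, r)) {1..<r}"
        by (auto simp: inj_on_def)
      have "(\<Prod>(i, j)\<in>P \<union> Pair r ` {r<..n} \<union> (\<lambda>s. (s, r)) ` {1..<r}. ?z i - ?z j) =
          (\<Prod>(i, j)\<in>P \<union> Pair r ` {r<..n}. ?z i - ?z j) * (\<Prod>(i, j)\<in>(\<lambda>s. (s, r)) ` {1..<r}. ?z i - ?z j)"
        using fin by (intro prod.union_disjoint) (auto simp: P_def)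
      also have "(\<Prod>(i, j)\<in>P \<union> Pair r ` {r<..n}. ?z i - ?z j) =
          (\<Prod>(i, j)\<in>P. ?z i - ?z j) * (\<Prod>(i, j)\<in>Pair r ` {r<..n}. ?z i - ?z j)"
        using fin by (intro prod.union_disjoint) (auto simp: P_def)
      finally show ?thesis
        by (simp only: prod.reindex[OF inj(1)] prod.reindex[OF inj(2)] o_def prod.case)
    qed
    also have "(\<Prod>(i, j)\<in>P. ?z i - ?z j) = (\<Prod>(i, j)\<in>P. z i - z j)"
      unfolding P_def by (rule prod.cong) auto
    also have "(\<Prod>s\<in>{r<..n}. ?z r - ?z s) = (\<Prod>s\<in>{r<..n}. v - z s)"
      by (rule prod.cong) auto
    also have "(\<Prod>s\<in>{1..<r}. ?z s - ?z r) = (\<Prod>s\<in>{1..<r}. z s - v)"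
      by (rule prod.cong) auto
    also have "\<dots> = (-1) ^ (r - 1) * (\<Prod>s\<in>{1..<r}. v - z s)"
      by (subst prod_neg_minus) simp
    also have "(\<Prod>(i, j)\<in>P. z i - z j) * (\<Prod>s\<in>{r<..n}. v - z s) * ((-1) ^ (r - 1) * (\<Prod>s\<in>{1..<r}. v - z s)) =
        C * (\<Prod>s\<in>{r<..n} \<union> {1..<r}. v - z s)"
      by (subst prod.union_disjoint) (auto simp: C_def)
    also have "{r<..n} \<union> {1..<r} = {1..n} - {r}" using r by auto
    finally show ?thesis .
  qed
  from this[of w] this[of "z r"] show ?thesis by simp
qed

lemma vandermonde_nonzero:
  assumes "inj_on z {1..n}"
  shows "vandermonde n z \<noteq> 0"
proof -
  have "z r - z s \<noteq> 0" if "r \<in> {1..n}" "s \<in> {r<..n}" for r s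
    using inj_onD[OF assms, of r s] that by auto
  then show ?thesis unfolding vandermonde_def by simp
qed

text \<open>Writing each factor with numerator x_r q^k_r - x_s q^k_s leaves a factor q^(-k_s). The
  index s is the larger one in s - 1 pairs, which accounts for the power of \<open>q\<close> on the
  left.\<close>

lemma vandermonde_quot_eq:
  assumes q: "q \<noteq> 0" and x: "\<And>r. r \<in> {1..n} \<Longrightarrow> x r \<noteq> 0"
  shows "vandermonde_quot n q x k * q ^ (\<Sum>r=1..n. (r - 1) * k r) =
         vandermonde n (\<lambda>r. x r * q ^ k r) / vandermonde n x"
proof -
  have "vandermonde_quot n q x k =
      (\<Prod>r=1..n. \<Prod>s\<in>{r<..n}. ((x r * q ^ k r - x s * q ^ k s) / (x r - x s)) / q ^ k s)"
    unfolding vandermonde_quot_def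
  proof (intro prod.cong refl)
    fix r s assume "r \<in> {1..n}" "s \<in> {r<..n}"
    then have x': "x r \<noteq> 0" "x s \<noteq> 0" using x by auto
    have e: "q powi (int (k r) - int (k s)) = q ^ k r / q ^ k s"
      using q by (simp add: power_int_diff)
    show "(1 - q powi (int (k r) - int (k s)) * (x r / x s)) / (1 - x r / x s) =
        ((x r * q ^ k r - x s * q ^ k s) / (x r - x s)) / q ^ k s"
      \<comment> \<open>If \<open>x r = x s\<close>, both sides are 0 by division by zero.\<close>
      unfolding e using x' q by (cases "x r = x s") (simp_all add: field_simps)
  qed
  also have "\<dots> = vandermonde n (\<lambda>r. x r * q ^ k r) / vandermonde n x /
      (\<Prod>r=1..n. \<Prod>s\<in>{r<..n}. q ^ k s)"
    by (simp add: vandermonde_def prod_dividef prod.distrib)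
  also have "(\<Prod>r=1..n. \<Prod>s\<in>{r<..n}. q ^ k s) = (\<Prod>s=1..n. \<Prod>r\<in>{1..<s}. q ^ k s)"
  proof -
    have "(\<Prod>r=1..n. \<Prod>s\<in>{r<..n}. q ^ k s) = (\<Prod>(r, s)\<in>(SIGMA r:{1..n}. {r<..n}). q ^ k s)"
      by (subst prod.Sigma) auto
    also have "\<dots> = (\<Prod>(s, r)\<in>(SIGMA s:{1..n}. {1..<s}). q ^ k s)"
      by (rule prod.reindex_bij_witness[of _ "\<lambda>(a, b). (b, a)" "\<lambda>(a, b). (b, a)"]) auto
    also have "\<dots> = (\<Prod>s=1..n. \<Prod>r\<in>{1..<s}. q ^ k s)"
      by (subst prod.Sigma) auto
    finally show ?thesis .
  qed
  also have "\<dots> = q ^ (\<Sum>r=1..n. (r - 1) * k r)"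
    by (simp add: power_sum power_mult[symmetric] mult.commute)
  finally show ?thesis using q by simp
qed

section \<open>q-shifted factorials and a telescoping sum\<close>

lemma qpoch_0 [simp]: "qpoch q z 0 = 1"
  by (simp add: qpoch_def)

lemma qpoch_Suc: "qpoch q z (Suc k) = qpoch q z k * (1 - z * q ^ k)"
  by (simp add: qpoch_def)

lemma qpoch_add: "qpoch q z (j + k) = qpoch q z j * qpoch q (z * q ^ j) k"
  by (induction k) (simp_all add: qpoch_Suc power_add mult_ac)

lemma qpoch_shift: "qpoch q z k * (1 - z * q ^ k) = (1 - z) * qpoch q (z * q) k"
  using qpoch_add[of q z 1 k] qpoch_Suc[of q z k] by (simp add: qpoch_def)

lemma qpoch_eq_0:
  assumes "q \<noteq> 0" "j < m" shows "qpoch q (q powi (- int j)) m = 0"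
  using assms unfolding qpoch_def by (auto simp: power_int_minus intro!: bexI[of _ j])

text \<open>Closed form of the partial sums, by induction on \<open>K\<close>. In the application
  \<open>p\<close> is |m| and \<open>P\<close> is |M|; at \<open>K = P\<close> the factor
  \<open>q ^ K - q ^ P\<close> makes the right-hand side vanish.\<close>

lemma telescoping_sum:
  fixes U :: "nat \<Rightarrow> complex"
  assumes U0: "(1 - q ^ p) * U 0 = 0"
    and US: "\<And>N. (q ^ Suc N - q ^ p) * U (Suc N) = (q ^ N - q ^ P) * U N"
    and nz: "\<And>k. qpoch q (\<alpha> * q ^ Suc P) k \<noteq> 0"
  shows "(q ^ p - q ^ P) * (\<Sum>N\<le>K. (1 - \<alpha> * q ^ (2 * N)) * qpoch q \<alpha> (N + p) /
           qpoch q (\<alpha> * q ^ Suc P) N * U N) =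
         qpoch q \<alpha> (Suc (K + p)) / qpoch q (\<alpha> * q ^ Suc P) K * (q ^ K - q ^ P) * U K"
proof (induction K)
  case 0
  show ?case
    \<comment> \<open>By \<open>U0\<close> either \<open>U 0 = 0\<close>, or
      \<open>q ^ p = 1\<close> and the two sides have the same factors.\<close>
    using U0 by (cases "p = 0") (auto simp: qpoch_Suc qpoch_def[of _ _ 0])
next
  case (Suc K)
  let ?A = "qpoch q \<alpha> (Suc (K + p)) :: complex" and ?B = "qpoch q (\<alpha> * q ^ Suc P) K"
    and ?c = "1 - \<alpha> * q ^ Suc P * q ^ K"
  have B': "qpoch q (\<alpha> * q ^ Suc P) (Suc K) = ?B * ?c" by (rule qpoch_Suc)
  then have c: "?c \<noteq> 0" "?B \<noteq> 0" using nz[of "Suc K"] by auto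
  \<comment> \<open>The recurrence \<open>US\<close>, read backwards, turns the closed form at
    \<open>K\<close> into a multiple of \<open>U (Suc K)\<close>, to be combined with the new
    summand.\<close>
  have e1: "?A / ?B * (q ^ K - q ^ P) * U K = ?A / (?B * ?c) * ?c * ((q ^ Suc K - q ^ p) * U (Suc K))"
    unfolding US using c by simp
  \<comment> \<open>This factorization makes the sum telescope: it supplies the next factor of the
    q-shifted factorial of \<open>\<alpha>\<close> and the next difference of powers.\<close>
  have e2: "?c * (q ^ Suc K - q ^ p) + (q ^ p - q ^ P) * (1 - \<alpha> * q ^ (2 * Suc K)) =
      (1 - \<alpha> * q ^ Suc (K + p)) * (q ^ Suc K - q ^ P)"
    by (simp add: algebra_simps power_add mult_2 mult_2_right power2_eq_square)
  have gen: "D * c * (Y * V) + E * F * D * V = D * (c * Y + E * F) * V" for D c Y V E F :: complex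
    by (simp add: algebra_simps)
  have "(q ^ p - q ^ P) * (\<Sum>N\<le>Suc K. (1 - \<alpha> * q ^ (2 * N)) * qpoch q \<alpha> (N + p) /
           qpoch q (\<alpha> * q ^ Suc P) N * U N) =
      ?A / ?B * (q ^ K - q ^ P) * U K +
      (q ^ p - q ^ P) * (1 - \<alpha> * q ^ (2 * Suc K)) * (?A / (?B * ?c)) * U (Suc K)"
    unfolding sum.atMost_Suc distrib_left Suc B' by simp
  also have "\<dots> = ?A / (?B * ?c) * (?c * (q ^ Suc K - q ^ p) + (q ^ p - q ^ P) * (1 - \<alpha> * q ^ (2 * Suc K))) * U (Suc K)"
    unfolding e1 by (rule gen)
  also have "\<dots> = ?A / (?B * ?c) * ((1 - \<alpha> * q ^ Suc (K + p)) * (q ^ Suc K - q ^ P)) * U (Suc K)"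
    unfolding e2 ..
  also have "\<dots> = qpoch q \<alpha> (Suc (Suc K + p)) / qpoch q (\<alpha> * q ^ Suc P) (Suc K) * (q ^ Suc K - q ^ P) * U (Suc K)"
    unfolding B' qpoch_Suc[of q \<alpha> "Suc K + p"] by simp
  finally show ?case .
qed

section \<open>Recurrences in the multi-index\<close>

text \<open>The conditions are purely algebraic and say that no denominator in \<open>x\<close>
  vanishes. They imply that \<open>q\<close> is not a root of unity and that the nodes x_r q^k_r are
  always pairwise distinct, as partial fractions require.\<close>

locale generic_nodes =
  fixes n :: nat and q :: complex and x :: "nat \<Rightarrow> complex"
  assumes n_pos: "n \<ge> 1" and q_nonzero: "q \<noteq> 0"
    and x_nonzero: "\<And>r. r \<in> {1..n} \<Longrightarrow> x r \<noteq> 0"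
    and x_distinct: "\<And>r s. r \<in> {1..n} \<Longrightarrow> s \<in> {1..n} \<Longrightarrow> r < s \<Longrightarrow> 1 - x r / x s \<noteq> 0"
    and qpoch_nonzero: "\<And>r s k. r \<in> {1..n} \<Longrightarrow> s \<in> {1..n} \<Longrightarrow> qpoch q (q * x r / x s) k \<noteq> 0"
begin

definition node :: "(nat \<Rightarrow> nat) \<Rightarrow> nat \<Rightarrow> complex" where
  "node k r = x r * q ^ k r"

definition denom :: "(nat \<Rightarrow> nat) \<Rightarrow> complex" where
  "denom k = (\<Prod>r=1..n. \<Prod>s=1..n. qpoch q (q * x r / x s) (k r))"

definition numer :: "(nat \<Rightarrow> nat) \<Rightarrow> (nat \<Rightarrow> nat) \<Rightarrow> complex" where
  "numer k m = (\<Prod>r=1..n. \<Prod>s=1..n. qpoch q (q powi (- int (k s)) * x r / x s) (m r))"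

text \<open>This is the factor T_k of the overview. The power of \<open>q\<close> with exponent
  \<Sum>(r - 1)k_r is absorbed into the Vandermonde product of the nodes, and the constant 1 /
  \<open>vandermonde n x\<close> is left out.\<close>

definition outer_term :: "(nat \<Rightarrow> complex) \<Rightarrow> (nat \<Rightarrow> nat) \<Rightarrow> (nat \<Rightarrow> nat) \<Rightarrow> complex" where
  "outer_term a m k = vandermonde n (node k) * num_poly n q x a k * numer k m / denom k"

lemma factor_nonzero:
  assumes "r \<in> {1..n}" "s \<in> {1..n}"
  shows "x s - q ^ Suc i * x r \<noteq> 0"
proof
  assume "x s - q ^ Suc i * x r = 0"
  then have "1 - q * x r / x s * q ^ i = 0"
    using x_nonzero[OF assms(2)] by (simp add: field_simps)
  then have "qpoch q (q * x r / x s) (Suc i) = 0" by (simp add: qpoch_Suc)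
  then show False using qpoch_nonzero[OF assms] by blast
qed

lemma q_power_neq_1: "q ^ Suc i \<noteq> 1"
  using factor_nonzero[of 1 1 i] n_pos by auto

lemma q_power_inj: "q ^ i = q ^ j \<Longrightarrow> i = j"
proof (induction i j rule: linorder_wlog)
  case (le i j)
  then have "q ^ (j - i) = 1" using q_nonzero by (simp add: power_diff)
  then show ?case using q_power_neq_1[of "j - i - 1"] le by (cases "i = j") (auto simp: Suc_diff_Suc simp del: power_Suc)
qed auto

lemma node_nonzero: "r \<in> {1..n} \<Longrightarrow> node k r \<noteq> 0"
  using x_nonzero q_nonzero by (simp add: node_def)

text \<open>Let k_r \<ge> k_s. Equal nodes would give x_s = q^(k_r - k_s) x_r, which contradicts x_r
  \<noteq> x_s if the exponent is 0 and \<open>factor_nonzero\<close> otherwise.\<close>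

lemma node_distinct:
  assumes "r \<in> {1..n}" "s \<in> {1..n}" "r \<noteq> s"
  shows "node k r \<noteq> node k s"
proof -
  have aux: False if "r \<in> {1..n}" "s \<in> {1..n}" "r \<noteq> s" "k r \<ge> k s" "node k r = node k s" for r s
  proof -
    have "x s = q ^ (k r - k s) * x r"
      using that q_nonzero by (simp add: node_def power_diff field_simps)
    moreover have "x r \<noteq> x s"
      using x_distinct[of r s] x_distinct[of s r] x_nonzero[of r] that by (cases r s rule: linorder_cases) auto
    ultimately show False
      using factor_nonzero[OF that(1,2), of "k r - k s - 1"] by (cases "k r = k s") (use that in \<open>auto simp: Suc_diff_Suc simp del: power_Suc\<close>)
  qed
  show ?thesis using aux[of r s] aux[of s r] assms by (metis nat_le_linear)
qed

lemma inj_on_node: "inj_on (node k) {1..n}"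
  using node_distinct by (meson inj_onI)

lemma node_upd: "node (k(r := Suc (k r))) = (node k)(r := q * node k r)"
  by (auto simp: node_def)

lemma vandermonde_step:
  assumes "r \<in> {1..n}"
  shows "vandermonde n (node (k(r := Suc (k r)))) * (\<Prod>s\<in>{1..n} - {r}. node k r - node k s) =
         vandermonde n (node k) * (\<Prod>s\<in>{1..n} - {r}. q * node k r - node k s)"
  unfolding node_upd by (rule vandermonde_fun_upd[OF assms])

lemma denom_nonzero: "denom k \<noteq> 0"
  unfolding denom_def using qpoch_nonzero by simp

lemma denom_step:
  assumes r: "r \<in> {1..n}"
  shows "denom (k(r := Suc (k r))) * (\<Prod>s=1..n. x s) = denom k * (\<Prod>s=1..n. x s - q * node k r)"
proof -
  let ?g = "\<lambda>r i. \<Prod>s=1..n. qpoch q (q * x r / x s) i"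
  have "?g r (Suc (k r)) = ?g r (k r) * (\<Prod>s=1..n. (x s - q * node k r) / x s)"
    unfolding qpoch_Suc prod.distrib
    using x_nonzero by (intro arg_cong2[of _ _ _ _ "(*)"] refl prod.cong) (auto simp: node_def field_simps)
  moreover have "?g r (k r) \<noteq> 0" using qpoch_nonzero r by simp
  moreover have "(\<Prod>s=1..n. x s) \<noteq> 0" using x_nonzero by simp
  ultimately show ?thesis
    using prod_fun_upd[of "{1..n}" r ?g k "Suc (k r)"] r
    by (simp add: denom_def prod_dividef field_simps)
qed

lemma num_poly_step:
  assumes r: "r \<in> {1..n}"
  shows "num_poly n q x a (k(r := Suc (k r))) * (\<Prod>s=1..n. x s) =
         num_poly n q x a k * (\<Prod>s=1..n. a s * x s - q * node k r)"
proof -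
  let ?h = "\<lambda>r s i. a s - q * x r / x s * q ^ i"
  let ?J = "{1..n} - {r}"
  have "num_poly n q x a (k(r := Suc (k r))) =
      (\<Prod>s=1..n. \<Prod>i<Suc (k r). ?h r s i) * (\<Prod>r\<in>?J. \<Prod>s=1..n. \<Prod>i<k r. ?h r s i)"
    unfolding num_poly_def using r by (subst prod.remove[of _ r]) (auto intro!: prod.cong)
  also have "(\<Prod>s=1..n. \<Prod>i<Suc (k r). ?h r s i) =
      (\<Prod>s=1..n. \<Prod>i<k r. ?h r s i) * (\<Prod>s=1..n. (a s * x s - q * node k r) / x s)"
    unfolding prod.lessThan_Suc prod.distrib
    using x_nonzero by (intro arg_cong2[of _ _ _ _ "(*)"] refl prod.cong) (auto simp: node_def field_simps)
  also have "\<dots> * (\<Prod>r\<in>?J. \<Prod>s=1..n. \<Prod>i<k r. ?h r s i) =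
      num_poly n q x a k * (\<Prod>s=1..n. (a s * x s - q * node k r) / x s)"
    unfolding num_poly_def using r by (subst (2) prod.remove[of _ r]) auto
  finally have e: "num_poly n q x a (k(r := Suc (k r))) =
      num_poly n q x a k * (\<Prod>s=1..n. (a s * x s - q * node k r) / x s)" .
  show ?thesis
    unfolding e prod_dividef using x_nonzero by simp
qed

text \<open>Raising k_r changes only the factors with x_r in the denominator. For each of them, with
  u = q^(-k_r - 1) x_s / x_r, the change is \<open>qpoch_shift\<close>, that is (u)_m (1 - u q^m) =
  (1 - u) (uq)_m.\<close>

lemma numer_step_lower:
  assumes r: "r \<in> {1..n}"
  shows "numer (k(r := Suc (k r))) m * (\<Prod>s=1..n. q * node k r - node m s) =
         numer k m * (\<Prod>s=1..n. q * node k r - x s)"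
proof -
  let ?h = "\<lambda>i j s. qpoch q (q powi (- int i) * x s / x j) (m s)"
  let ?J = "{1..n} - {r}"
  have expand: "numer k' m = (\<Prod>s=1..n. ?h (k' r) r s) * (\<Prod>j\<in>?J. \<Prod>s=1..n. ?h (k' j) j s)" for k'
    unfolding numer_def using r by (subst prod.swap) (auto simp: prod.remove[of _ r])
  have one: "?h (Suc (k r)) r s * (q * node k r - node m s) = ?h (k r) r s * (q * node k r - x s)"
    if s: "s \<in> {1..n}" for s
  proof -
    have pm: "q powi (- int i) = inverse (q ^ i)" for i
      by (simp add: power_int_minus)
    define u where "u = inverse (q ^ Suc (k r)) * x s / x r"
    have u: "x s = u * (q * node k r)"
      using q_nonzero x_nonzero[OF r] by (simp add: u_def node_def field_simps)
    have uq: "inverse (q ^ k r) * x s / x r = u * q"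
      using q_nonzero by (simp add: u_def)
    have "qpoch q u (m s) * (1 - u * q ^ m s) * (q * node k r) = (1 - u) * qpoch q (u * q) (m s) * (q * node k r)"
      by (simp only: qpoch_shift)
    moreover have "q * node k r - x s = (1 - u) * (q * node k r)"
      and "q * node k r - node m s = (1 - u * q ^ m s) * (q * node k r)"
      using u by (simp_all add: node_def[of m s] algebra_simps)
    ultimately show ?thesis
      unfolding pm uq u_def[symmetric] by (simp add: mult_ac)
  qed
  have "(\<Prod>s=1..n. ?h (Suc (k r)) r s) * (\<Prod>s=1..n. q * node k r - node m s) =
      (\<Prod>s=1..n. ?h (k r) r s) * (\<Prod>s=1..n. q * node k r - x s)"
    unfolding prod.distrib[symmetric] by (rule prod.cong[OF refl one])
  moreover have "(\<Prod>j\<in>?J. \<Prod>s=1..n. ?h ((k(r := Suc (k r))) j) j s) = (\<Prod>j\<in>?J. \<Prod>s=1..n. ?h (k j) j s)"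
    by (rule prod.cong) auto
  ultimately show ?thesis
    unfolding expand[of k] expand[of "k(r := Suc (k r))"] by simp
qed

text \<open>The diagonal factor with base q^(-k_r) contains a zero. Hence inner sums over m \<le> k
  may be extended to any larger box.\<close>

lemma numer_eq_0:
  assumes "r \<in> {1..n}" "k r < m r"
  shows "numer k m = 0"
proof -
  have "qpoch q (q powi (- int (k r)) * x r / x r) (m r) = 0"
    using qpoch_eq_0[OF q_nonzero assms(2)] x_nonzero[OF assms(1)] by simp
  then show ?thesis unfolding numer_def using assms(1) by (auto intro!: bexI[of _ r])
qed

text \<open>Product of the four one-step rules. The signs (-1)^n and the product of the x_s cancel
  between \<open>denom_step\<close> and \<open>num_poly_step\<close>, and \<open>Y\<close> cancels
  between \<open>denom_step\<close> and \<open>numer_step_lower\<close>.\<close>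

lemma outer_term_step:
  assumes r: "r \<in> {1..n}"
  shows "outer_term a m (k(r := Suc (k r))) * (\<Prod>s=1..n. q * node k r - node m s) *
           (\<Prod>s\<in>{1..n} - {r}. node k r - node k s) =
         outer_term a m k * (\<Prod>s=1..n. q * node k r - a s * x s) *
           (\<Prod>s\<in>{1..n} - {r}. q * node k r - node k s)"
proof -
  define k' where "k' = k(r := Suc (k r))"
  define X where "X = (\<Prod>s=1..n. x s)"
  define e where "e = (-1 :: complex) ^ n"
  define Y where "Y = (\<Prod>s=1..n. q * node k r - x s)"
  define W where "W = (\<Prod>s=1..n. q * node k r - a s * x s)"
  note facts = vandermonde_step[OF r, of k] denom_step[OF r, of k] num_poly_step[OF r, of a k] numer_step_lower[OF r, of k m]
  have eX: "e \<noteq> 0" "X \<noteq> 0" using x_nonzero by (auto simp: e_def X_def)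
  have Y: "(\<Prod>s=1..n. x s - q * node k r) = e * Y"
    unfolding e_def Y_def by (subst prod_neg_minus) simp
  have W: "(\<Prod>s=1..n. a s * x s - q * node k r) = e * W"
    unfolding e_def W_def by (subst prod_neg_minus) simp
  have Y0: "Y \<noteq> 0" using factor_nonzero[OF r, of _ "k r"] by (fastforce simp: Y_def node_def mult_ac)
  have d: "denom k' = denom k * (e * Y) / X"
    using facts(2) eX unfolding Y X_def[symmetric] k'_def[symmetric] by (simp add: field_simps)
  have p: "num_poly n q x a k' = num_poly n q x a k * (e * W) / X"
    using facts(3) eX unfolding W X_def[symmetric] k'_def[symmetric] by (simp add: field_simps)
  have "outer_term a m k' * (\<Prod>s=1..n. q * node k r - node m s) * (\<Prod>s\<in>{1..n} - {r}. node k r - node k s) =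
     (vandermonde n (node k') * (\<Prod>s\<in>{1..n} - {r}. node k r - node k s)) *
     (numer k' m * (\<Prod>s=1..n. q * node k r - node m s)) * num_poly n q x a k' / denom k'"
    unfolding outer_term_def by simp
  also have "\<dots> = outer_term a m k * W * (\<Prod>s\<in>{1..n} - {r}. q * node k r - node k s)"
    unfolding k'_def facts(1,4) unfolding k'_def[symmetric] d p Y_def[symmetric] outer_term_def
    using eX Y0 denom_nonzero[of k] by (simp add: field_simps)
  finally show ?thesis unfolding k'_def W_def .
qed

lemma prod_node: "(\<Prod>s=1..n. node k s) = (\<Prod>s=1..n. x s) * q ^ msize n k"
  by (simp add: node_def prod.distrib msize_def power_sum)

end

section \<open>Sums over the levels |k| = N and their recurrence\<close>

definition level :: "nat \<Rightarrow> nat \<Rightarrow> (nat \<Rightarrow> nat) set" where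
  "level n N = {k \<in> multi_indices n. msize n k = N}"

lemma level_subset_box: "level n N \<subseteq> ({1..n} \<rightarrow>\<^sub>E {..N})"
proof
  fix k assume k: "k \<in> level n N"
  have "k r \<le> N" if "r \<in> {1..n}" for r
  proof -
    have "k r \<le> (\<Sum>r=1..n. k r)" using that by (intro member_le_sum) auto
    then show ?thesis using k by (simp add: level_def msize_def)
  qed
  then show "k \<in> ({1..n} \<rightarrow>\<^sub>E {..N})"
    using k by (auto simp: level_def multi_indices_def PiE_iff)
qed

lemma finite_level: "finite (level n N)"
  by (rule finite_subset[OF level_subset_box]) (auto intro: finite_PiE)

context generic_nodes
begin

text \<open>Partial fractions with c_s = 1 and b_s = x_s q^m_s; the product of the x_s cancels from
  the quotient of node products.\<close>

lemma sum_prod_node_diff: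
  "(\<Sum>r=1..n. (\<Prod>s=1..n. node k r - node m s) / (node k r * (\<Prod>s\<in>{1..n} - {r}. node k r - node k s))) =
    1 - q ^ msize n m / q ^ msize n k"
proof -
  have "(\<Prod>s=1..n. x s) \<noteq> 0" using x_nonzero by simp
  then show ?thesis
    using partial_fractions_sum[of "{1..n}" "node k" "\<lambda>_. 1" "node m"] node_nonzero inj_on_node
    by (simp add: prod_node[unfolded One_nat_def])
qed

text \<open>Partial fractions with c_s = q and b_s = a_s x_s.\<close>

lemma sum_prod_scaled_node_diff:
  "(\<Sum>r=1..n. (\<Prod>s=1..n. q * node k r - a s * x s) / (node k r * (\<Prod>s\<in>{1..n} - {r}. node k r - node k s))) =
    q ^ n - (\<Prod>s=1..n. a s) / q ^ msize n k"
proof -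
  have "(\<Prod>s=1..n. x s) \<noteq> 0" using x_nonzero by simp
  then show ?thesis
    using partial_fractions_sum[of "{1..n}" "node k" "\<lambda>_. q" "\<lambda>s. a s * x s"] node_nonzero inj_on_node
    by (simp add: prod_node[unfolded One_nat_def] prod.distrib)
qed

lemma prod_node_diff_nonzero:
  assumes "r \<in> {1..n}"
  shows "(\<Prod>s\<in>{1..n} - {r}. node k r - node k s) \<noteq> 0"
  using node_distinct[OF assms] by auto

text \<open>This is the product of node differences at the index with k_r raised by one.\<close>

lemma prod_scaled_node_diff_nonzero:
  assumes "r \<in> {1..n}"
  shows "(\<Prod>s\<in>{1..n} - {r}. q * node k r - node k s) \<noteq> 0"
proof -
  have "(\<Prod>s\<in>{1..n} - {r}. q * node k r - node k s) =
      (\<Prod>s\<in>{1..n} - {r}. node (k(r := Suc (k r))) r - node (k(r := Suc (k r))) s)"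
    unfolding node_upd by (rule prod.cong) auto
  then show ?thesis using prod_node_diff_nonzero[OF assms] by simp
qed

text \<open>If m_r = 0, the factor s = r of the product vanishes; if m_r > 0, \<open>numer\<close>
  vanishes. This removes the boundary terms k_r = 0, which have no predecessor in direction
  r.\<close>

lemma outer_term_eq_0:
  assumes "r \<in> {1..n}" "k r = 0"
  shows "outer_term a m k * (\<Prod>s=1..n. node k r - node m s) = 0"
proof (cases "m r = 0")
  case True
  then have "node k r - node m r = 0" using assms by (simp add: node_def)
  then have "(\<Prod>s=1..n. node k r - node m s) = 0" using assms(1) by (intro prod_zero) auto
  then show ?thesis by simp
next
  case False
  then show ?thesis using numer_eq_0[of r k m] assms by (simp add: outer_term_def)
qed

text \<open>Each side is expanded by one of the two partial fraction sums: \<open>g k r\<close> and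
  \<open>h k r\<close> are the resulting summands. \<open>outer_term_step\<close> says that raising
  k_r turns \<open>h k r\<close> into \<open>g\<close>, so the two double sums agree after shifting
  \<open>k\<close> by a unit vector.\<close>

lemma sum_outer_term_step:
  fixes a :: "nat \<Rightarrow> complex" and m :: "nat \<Rightarrow> nat"
  shows "(q ^ Suc N - q ^ msize n m) * (\<Sum>k\<in>level n (Suc N). outer_term a m k) =
         (q ^ (n + N) - (\<Prod>s=1..n. a s)) * (\<Sum>k\<in>level n N. outer_term a m k)"
proof -
  let ?I = "{1..n}"
  define g where "g k r = outer_term a m k * (\<Prod>s=1..n. node k r - node m s) /
      (node k r * (\<Prod>s\<in>?I - {r}. node k r - node k s))" for k r
  define h where "h k r = outer_term a m k * (\<Prod>s=1..n. q * node k r - a s * x s) /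
      (q * node k r * (\<Prod>s\<in>?I - {r}. node k r - node k s))" for k r
  have step: "g (k(r := Suc (k r))) r = h k r" if r: "r \<in> ?I" for k r
  proof -
    have "(\<Prod>s\<in>?I - {r}. node (k(r := Suc (k r))) r - node (k(r := Suc (k r))) s) =
        (\<Prod>s\<in>?I - {r}. q * node k r - node k s)"
      unfolding node_upd by (rule prod.cong) auto
    moreover have "node (k(r := Suc (k r))) r = q * node k r"
      unfolding node_upd by simp
    ultimately show ?thesis
      using outer_term_step[OF r, of a m k] prod_node_diff_nonzero[OF r, of k]
        prod_scaled_node_diff_nonzero[OF r, of k] node_nonzero[OF r, of k] q_nonzero
      unfolding g_def h_def by (simp add: field_simps)
  qed
  have "(1 - q ^ msize n m / q ^ Suc N) * (\<Sum>k\<in>level n (Suc N). outer_term a m k) =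
      (\<Sum>k\<in>level n (Suc N). \<Sum>r\<in>?I. g k r)"
    unfolding sum_distrib_left
  proof (rule sum.cong[OF refl])
    fix k assume "k \<in> level n (Suc N)"
    then have k: "msize n k = Suc N" by (simp add: level_def)
    have "(\<Sum>r\<in>?I. g k r) = outer_term a m k * (1 - q ^ msize n m / q ^ msize n k)"
      unfolding g_def sum_prod_node_diff[symmetric] sum_distrib_left by simp
    then show "(1 - q ^ msize n m / q ^ Suc N) * outer_term a m k = (\<Sum>r\<in>?I. g k r)"
      unfolding k by simp
  qed
  also have "\<dots> = (\<Sum>(k, r)\<in>level n (Suc N) \<times> ?I. g k r)"
    by (simp add: sum.cartesian_product)
  also have "\<dots> = (\<Sum>(k, r)\<in>{(k, r) \<in> level n (Suc N) \<times> ?I. 0 < k r}. g k r)"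
  proof (rule sum.mono_neutral_right)
    show "\<forall>i\<in>level n (Suc N) \<times> ?I - {(k, r) \<in> level n (Suc N) \<times> ?I. 0 < k r}. (case i of (k, r) \<Rightarrow> g k r) = 0"
    proof
      fix p assume p: "p \<in> level n (Suc N) \<times> ?I - {(k, r) \<in> level n (Suc N) \<times> ?I. 0 < k r}"
      obtain k r where kr: "p = (k, r)" by (cases p)
      have rk: "r \<in> ?I" "k r = 0"
        using p unfolding kr by simp_all
      have "g k r = 0" unfolding g_def outer_term_eq_0[of r k, OF rk] by (rule div_0)
      then show "(case p of (k, r) \<Rightarrow> g k r) = 0" using kr by simp
    qed
  qed (auto simp: finite_level)
  also have "\<dots> = (\<Sum>(k, r)\<in>level n N \<times> ?I. h k r)"
  \<comment> \<open>The bijection raises k_r by one in one direction and lowers it in the other; it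
    leaves \<open>r\<close> fixed.\<close>
  proof (rule sum.reindex_bij_witness[of _ "\<lambda>(k, r). (k(r := Suc (k r)), r)" "\<lambda>(k, r). (k(r := k r - 1), r)"])
    fix p assume p: "p \<in> {(k, r) \<in> level n (Suc N) \<times> ?I. 0 < k r}"
    obtain k r where kr: "p = (k, r)" by (cases p)
    define k0 where "k0 = k(r := k r - 1)"
    have k: "k \<in> level n (Suc N)" "r \<in> ?I" "k = k0(r := Suc (k0 r))"
      using p unfolding kr k0_def by auto
    have "msize n (k0(r := Suc (k0 r))) = Suc (msize n k0)"
      unfolding msize_def by (rule sum_fun_upd_Suc) (use k(2) in auto)
    then have "msize n k = Suc (msize n k0)"
      unfolding k(3)[symmetric] .
    moreover have "k0 \<in> multi_indices n"
      using k(1,2) unfolding k0_def level_def multi_indices_def by (auto simp: PiE_iff extensional_def)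
    ultimately have k0: "k0 \<in> level n N" using k(1) by (simp add: level_def)
    show "(case case p of (k, r) \<Rightarrow> (k(r := k r - 1), r) of (k, r) \<Rightarrow> (k(r := Suc (k r)), r)) = p"
      using p kr by auto
    show "(case p of (k, r) \<Rightarrow> (k(r := k r - 1), r)) \<in> level n N \<times> ?I"
      using k0 k(2) kr by (simp add: k0_def)
    have "h k0 r = g k r"
      using step[OF k(2), of k0] unfolding k(3)[symmetric] by simp
    then show "(case case p of (k, r) \<Rightarrow> (k(r := k r - 1), r) of (k, r) \<Rightarrow> h k r) = (case p of (k, r) \<Rightarrow> g k r)"
      using kr by (simp add: k0_def)
  next
    fix p assume p: "p \<in> level n N \<times> ?I"
    obtain k r where kr: "p = (k, r)" by (cases p)
    have k: "k \<in> level n N" "r \<in> ?I" using p kr by auto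
    have "msize n (k(r := Suc (k r))) = Suc (msize n k)"
      unfolding msize_def by (rule sum_fun_upd_Suc) (use k in auto)
    then have "k(r := Suc (k r)) \<in> level n (Suc N)"
      using k unfolding level_def multi_indices_def by (auto simp: PiE_iff extensional_def)
    then show "(case p of (k, r) \<Rightarrow> (k(r := Suc (k r)), r)) \<in> {(k, r) \<in> level n (Suc N) \<times> ?I. 0 < k r}"
      using k kr by simp
    show "(case case p of (k, r) \<Rightarrow> (k(r := Suc (k r)), r) of (k, r) \<Rightarrow> (k(r := k r - 1), r)) = p"
      using kr by simp
  qed
  also have "\<dots> = (\<Sum>k\<in>level n N. \<Sum>r\<in>?I. h k r)"
    by (simp add: sum.cartesian_product)
  also have "\<dots> = (q ^ n - (\<Prod>s=1..n. a s) / q ^ N) / q * (\<Sum>k\<in>level n N. outer_term a m k)"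
    unfolding sum_distrib_left
  proof (rule sum.cong[OF refl])
    fix k assume "k \<in> level n N"
    then have k: "msize n k = N" by (simp add: level_def)
    have "(\<Sum>r\<in>?I. h k r) = outer_term a m k / q * (q ^ n - (\<Prod>s=1..n. a s) / q ^ msize n k)"
      unfolding h_def sum_prod_scaled_node_diff[symmetric] sum_distrib_left by (simp add: mult_ac)
    then show "(\<Sum>r\<in>?I. h k r) = (q ^ n - (\<Prod>s=1..n. a s) / q ^ N) / q * outer_term a m k"
      unfolding k by simp
  qed
  finally have eq: "(1 - q ^ msize n m / q ^ Suc N) * (\<Sum>k\<in>level n (Suc N). outer_term a m k) =
      (q ^ n - (\<Prod>s=1..n. a s) / q ^ N) / q * (\<Sum>k\<in>level n N. outer_term a m k)" .
  \<comment> \<open>Multiplying by \<open>q ^ Suc N\<close> clears the denominators on both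
    sides.\<close>
  have "q ^ Suc N - q ^ msize n m = q ^ Suc N * (1 - q ^ msize n m / q ^ Suc N)"
    and "q ^ (n + N) - (\<Prod>s=1..n. a s) = q ^ Suc N * ((q ^ n - (\<Prod>s=1..n. a s) / q ^ N) / q)"
    using q_nonzero by (simp_all add: field_simps power_add)
  then show ?thesis by (simp only: mult.assoc eq)
qed

text \<open>Initial condition of the recurrence: on level 0 every entry of \<open>k\<close> is 0, so
  \<open>numer\<close> vanishes as soon as some m_r is positive.\<close>

lemma sum_outer_term_0: "(1 - q ^ msize n m) * (\<Sum>k\<in>level n 0. outer_term a m k) = 0"
proof (cases "msize n m = 0")
  case False
  then obtain r where r: "r \<in> {1..n}" "m r \<noteq> 0" by (auto simp: msize_def)
  have "outer_term a m k = 0" if "k \<in> level n 0" for k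
  proof -
    have "k r = 0" using that r by (simp add: level_def msize_def)
    then show ?thesis using numer_eq_0[of r k m] r by (simp add: outer_term_def)
  qed
  then show ?thesis by simp
qed simp

section \<open>Evaluation of the diagonal term\<close>

text \<open>Both arguments of \<open>numer\<close> grow here. The first is raised by
  \<open>numer_step_lower\<close>; the second appends one more factor to each q-shifted factorial in
  row \<open>r\<close>, and these factors form the quotient in \<open>G\<close>. All node
  differences then cancel.\<close>

lemma diagonal_step:
  assumes r: "r \<in> {1..n}"
  defines "E \<equiv> \<lambda>k. vandermonde n (node k) * numer k k / denom k"
  shows "E (k(r := Suc (k r))) = - E k / q ^ Suc (msize n k)"
proof -
  define k' where "k' = k(r := Suc (k r))"
  define X where "X = (\<Prod>s=1..n. x s)"
  define e where "e = (-1 :: complex) ^ n"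
  define Y where "Y = (\<Prod>s=1..n. q * node k r - x s)"
  define A where "A = (\<Prod>s\<in>{1..n} - {r}. node k r - node k s)"
  define B where "B = (\<Prod>s\<in>{1..n} - {r}. q * node k r - node k s)"
  define Z where "Z = (\<Prod>s\<in>{1..n} - {r}. node k s)"
  have eX: "e \<noteq> 0" "X \<noteq> 0" using x_nonzero by (auto simp: e_def X_def)
  have Y: "(\<Prod>s=1..n. x s - q * node k r) = e * Y"
    unfolding e_def Y_def by (subst prod_neg_minus) simp
  have Y0: "Y \<noteq> 0" using factor_nonzero[OF r, of _ "k r"] by (fastforce simp: Y_def node_def mult_ac)
  have A0: "A \<noteq> 0" and B0: "B \<noteq> 0" and z0: "node k r \<noteq> 0"
    using prod_node_diff_nonzero[OF r] prod_scaled_node_diff_nonzero[OF r] node_nonzero[OF r]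
    by (simp_all add: A_def B_def)
  have Z0: "Z \<noteq> 0" using node_nonzero by (simp add: Z_def)
  have q1: "q \<noteq> 1" using q_power_neq_1[of 0] by simp
  have v: "vandermonde n (node k') = vandermonde n (node k) * B / A"
    using vandermonde_step[OF r, of k] A0 unfolding k'_def[symmetric] A_def[symmetric] B_def[symmetric]
    by (simp add: nonzero_eq_divide_eq)
  have d: "denom k' = denom k * (e * Y) / X"
    using denom_step[OF r, of k] eX unfolding Y X_def[symmetric] k'_def[symmetric] by (simp add: field_simps)
  \<comment> \<open>The factor s = r is split off; it is nonzero because q \<noteq> 1.\<close>
  have "(\<Prod>s=1..n. q * node k r - node k s) = (q - 1) * node k r * B"
    unfolding B_def using r by (subst prod.remove[of _ r]) (auto simp: algebra_simps)
  then have "numer k' k * ((q - 1) * node k r * B) = numer k k * Y"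
    using numer_step_lower[OF r, of k k] unfolding k'_def Y_def by argo
  then have lower: "numer k' k = numer k k * Y / ((q - 1) * node k r * B)"
    using q1 z0 B0 by (subst nonzero_eq_divide_eq) auto
  let ?G = "\<lambda>r i. \<Prod>s=1..n. qpoch q (q powi (- int (k' s)) * x r / x s) i"
  have upper: "numer k' k' * ?G r (k r) = numer k' k * ?G r (Suc (k r))"
    using prod_fun_upd[of "{1..n}" r ?G k "Suc (k r)"] r by (simp add: numer_def k'_def)
  have G: "?G r (Suc (k r)) = ?G r (k r) * ((1 - 1 / q) * (e * A / (- Z)))"
  proof -
    have "?G r (Suc (k r)) = ?G r (k r) * (\<Prod>s=1..n. 1 - node k r / node k' s)"
      unfolding qpoch_Suc prod.distrib
      by (intro arg_cong2[of _ _ _ _ "(*)"] refl prod.cong)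
         (simp add: node_def power_int_minus field_simps)
    also have "(\<Prod>s=1..n. 1 - node k r / node k' s) =
        (1 - 1 / q) * (\<Prod>s\<in>{1..n} - {r}. 1 - node k r / node k' s)"
      using r z0 q_nonzero by (subst prod.remove[of _ r]) (auto simp: k'_def node_upd)
    also have "(\<Prod>s\<in>{1..n} - {r}. 1 - node k r / node k' s) =
        (\<Prod>s\<in>{1..n} - {r}. (node k s - node k r) / node k s)"
      by (rule prod.cong) (auto simp: k'_def node_upd node_nonzero diff_divide_distrib)
    also have "\<dots> = (-1) ^ (n - 1) * A / Z"
      unfolding prod_dividef A_def Z_def by (subst prod_neg_minus) (use r in simp)
    also have "\<dots> = e * A / (- Z)"
      using n_pos by (cases n) (simp_all add: e_def)
    finally show ?thesis .
  qed
  \<comment> \<open>A vanishing factor would identify \<open>node k' s\<close> with x_r q^i for some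
    i < k_r. Distinctness of the nodes of \<open>k'(r := i)\<close> forces s = r, and then i = k_r +
    1, a contradiction.\<close>
  have G0: "?G r (k r) \<noteq> 0"
  proof -
    have nz: "1 - q powi (- int (k' s)) * x r / x s * q ^ i \<noteq> 0" if s: "s \<in> {1..n}" "i < k r" for s i
    proof
      assume "1 - q powi (- int (k' s)) * x r / x s * q ^ i = 0"
      then have "node (k'(r := i)) r = node k' s"
        using q_nonzero x_nonzero[OF s(1)] by (simp add: node_def power_int_minus field_simps)
      moreover have "node k' s = node (k'(r := i)) s" if "s \<noteq> r" using that by (simp add: node_def)
      ultimately have "s = r" using node_distinct[OF r s(1), of "k'(r := i)"] by auto
      then have "q ^ i = q ^ Suc (k r)"
        using \<open>node (k'(r := i)) r = node k' s\<close> x_nonzero[OF r] by (simp add: node_def k'_def)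
      then have "i = Suc (k r)" by (rule q_power_inj)
      then show False using s by simp
    qed
    show ?thesis
      unfolding qpoch_def prod_zero_iff[OF finite_atLeastAtMost] prod_zero_iff[OF finite_lessThan]
    proof (intro notI, elim bexE)
      fix s i assume "s \<in> {1..n}" "i \<in> {..<k r}"
        and "1 - q powi (- int (k' s)) * x r / x s * q ^ i = 0"
      then show False using nz[of s i] by (simp only: lessThan_iff)
    qed
  qed
  have "numer k' k' * ?G r (k r) =
      numer k k * Y / ((q - 1) * node k r * B) * ((1 - 1 / q) * (e * A / (- Z))) * ?G r (k r)"
    unfolding upper G lower by (simp only: mult.assoc mult.commute[of "?G r (k r)"])
  then have nu: "numer k' k' = numer k k * Y / ((q - 1) * node k r * B) * ((1 - 1 / q) * (e * A / (- Z)))"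
    by (rule mult_right_cancel[OF G0, THEN iffD1])
  have XZ: "X * q ^ msize n k = node k r * Z"
    unfolding X_def prod_node[symmetric] Z_def using r by (subst prod.remove[of _ r]) auto
  have "E k' = E k * (- X / (q * (node k r * Z)))"
    unfolding E_def v d nu using A0 B0 Y0 Z0 z0 eX q1 q_nonzero denom_nonzero[of k]
    by (simp add: field_simps)
  also have "\<dots> = - E k / q ^ Suc (msize n k)"
    unfolding XZ[symmetric] using eX q_nonzero by (simp add: field_simps)
  finally show ?thesis unfolding k'_def .
qed

text \<open>Iterating \<open>diagonal_step\<close> gives \<open>vandermonde n x\<close> up to sign,
  divided by q^(1 + 2 + ... + |k|). Squaring removes the sign and the halved exponent, and the
  square is exactly what the diagonal term contains.\<close>

lemma diagonal_square:
  "(vandermonde n (node k) * numer k k / denom k)\<^sup>2 * q ^ (msize n k * Suc (msize n k)) = (vandermonde n x)\<^sup>2"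
proof (induction "msize n k" arbitrary: k)
  case 0
  then have k: "k r = 0" if "r \<in> {1..n}" for r using that by (simp add: msize_def)
  have "vandermonde n (node k) = vandermonde n x"
    unfolding vandermonde_def by (intro prod.cong) (auto simp: node_def k)
  moreover have "numer k k = 1" "denom k = 1"
    unfolding numer_def denom_def by (auto intro!: prod.neutral simp: k)
  ultimately show ?case using 0 by simp
next
  case (Suc N)
  then have "\<exists>r\<in>{1..n}. k r \<noteq> 0"
    unfolding msize_def by (metis sum.neutral nat.distinct(1))
  then obtain r where r: "r \<in> {1..n}" "k r \<noteq> 0" by blast
  define k0 where "k0 = k(r := k r - 1)"
  have k: "k = k0(r := Suc (k0 r))" using r by (auto simp: k0_def)
  have "msize n (k0(r := Suc (k0 r))) = Suc (msize n k0)"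
    unfolding msize_def by (rule sum_fun_upd_Suc) (use r in auto)
  then have "msize n k = Suc (msize n k0)"
    unfolding k[symmetric] .
  then have N: "N = msize n k0" using Suc by simp
  let ?E = "\<lambda>k. vandermonde n (node k) * numer k k / denom k"
  have E: "?E k = - ?E k0 / q ^ Suc N"
    using diagonal_step[OF r(1), of k0] unfolding k[symmetric] N .
  have p: "q ^ (Suc N * Suc (Suc N)) = q ^ (N * Suc N) * (q ^ Suc N)\<^sup>2"
    unfolding power_mult[symmetric] power_add[symmetric] by (rule arg_cong[of _ _ "power q"]) simp
  have "(?E k)\<^sup>2 * q ^ (Suc N * Suc (Suc N)) = (?E k0)\<^sup>2 * q ^ (N * Suc N)"
    unfolding E p power_divide power2_minus using q_nonzero by simp
  then show ?case using Suc.hyps(1)[OF N] unfolding Suc.hyps(2)[symmetric] N[symmetric] by simp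
qed

end

section \<open>Infinite q-products\<close>

lemma convergent_prod_qpoch:
  assumes "norm q < 1"
  shows "convergent_prod (\<lambda>i. 1 - z * q ^ i :: complex)"
proof -
  have "abs_convergent_prod (\<lambda>i. 1 - z * q ^ i)"
    using assms by (intro summable_imp_abs_convergent_prod)
      (simp add: norm_mult norm_power summable_mult summable_geometric)
  then show ?thesis by (rule abs_convergent_prod_imp_convergent_prod)
qed

lemma qpoch_inf_split:
  assumes "norm q < 1"
  shows "qpoch_inf q z = qpoch q z k * qpoch_inf q (z * q ^ k)"
proof -
  have "(\<lambda>i. 1 - z * q ^ i) has_prod ((\<Prod>i<k. 1 - z * q ^ i) * (\<Prod>i. 1 - z * q ^ (i + k)))"
    by (rule has_prod_ignore_initial_segment'[OF convergent_prod_qpoch[OF assms]])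
  then show ?thesis
    unfolding qpoch_inf_def qpoch_def by (simp add: has_prod_unique[symmetric] power_add mult_ac)
qed

lemma qpoch_factor_nonzero:
  fixes z :: complex
  assumes "norm q < 1" "norm z < 1"
  shows "1 - z * q ^ i \<noteq> 0"
proof -
  have "norm (z * q ^ i) \<le> norm z"
    using assms(1) by (simp add: norm_mult norm_power mult_left_le power_le_one)
  then have "norm (z * q ^ i) < 1" using assms(2) by linarith
  then show ?thesis by (metis eq_iff_diff_eq_0 norm_one less_irrefl)
qed

lemma qpoch_small_nonzero:
  assumes "norm q < 1" "norm z < 1"
  shows "qpoch q z k \<noteq> 0" "qpoch_inf q z \<noteq> 0"
  using qpoch_factor_nonzero[OF assms] prodinf_nonzero[OF convergent_prod_qpoch[OF assms(1)], of z]
  by (simp_all add: qpoch_def qpoch_inf_def)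

section \<open>The terminating case\<close>

context generic_nodes
begin

text \<open>The factor with both indices equal to \<open>r\<close> and i = M_r is q^(M_r + 1) - q
  q^M_r = 0. This is why the outer series terminates.\<close>

lemma num_poly_eq_0:
  assumes "r \<in> {1..n}" "M r < k r" "a r = q ^ Suc (M r)"
  shows "num_poly n q x a k = 0"
proof -
  have "\<exists>i\<in>{..<k r}. a r - q * x r / x r * q ^ i = 0"
    using assms x_nonzero[OF assms(1)] by (intro bexI[of _ "M r"]) auto
  then have "(\<Prod>i<k r. a r - q * x r / x r * q ^ i) = 0"
    by (intro prod_zero) auto
  then have "(\<Prod>s=1..n. \<Prod>i<k r. a s - q * x r / x s * q ^ i) = 0"
    using assms(1) by (intro prod_zero[OF finite_atLeastAtMost]) blast
  then show ?thesis
    unfolding num_poly_def using assms(1) by (intro prod_zero[OF finite_atLeastAtMost]) blast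
qed

lemma prod_q_powers:
  assumes a: "\<And>r. r \<in> {1..n} \<Longrightarrow> a r = q ^ Suc (M r)"
  shows "(\<Prod>s=1..n. a s) = q ^ (msize n M + n)"
  using a by (simp add: msize_def power_add power_sum prod.distrib)

lemma shifted_prod_q_powers:
  assumes a: "\<And>r. r \<in> {1..n} \<Longrightarrow> a r = q ^ Suc (M r)"
  shows "\<alpha> * (\<Prod>r=1..n. a r) * q powi (1 - int n) = \<alpha> * q ^ Suc (msize n M)"
proof -
  have "(\<Prod>r=1..n. a r) = q ^ (msize n M + n)" by (rule prod_q_powers) (rule a)
  then show ?thesis using q_nonzero by (simp add: power_int_diff power_add)
qed

text \<open>For a_s = q^(M_s + 1) the argument q x_r / (x_s a_s) is q^(-M_s) x_r / x_s, which is
  that of \<open>numer M M\<close>.\<close>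

lemma num_poly_diagonal:
  assumes a: "\<And>r. r \<in> {1..n} \<Longrightarrow> a r = q ^ Suc (M r)"
  shows "num_poly n q x a M = numer M M * q ^ ((msize n M + n) * msize n M)"
proof -
  have "(\<Prod>r=1..n. \<Prod>s=1..n. qpoch q (q * x r / (x s * a s)) (M r)) = numer M M"
    unfolding numer_def
  proof (intro prod.cong refl)
    fix r s assume "r \<in> {1..n}" "s \<in> {1..n}"
    then have "q * x r / (x s * a s) = q powi - int (M s) * x r / x s"
      using q_nonzero x_nonzero by (simp add: a power_int_minus field_simps)
    then show "qpoch q (q * x r / (x s * a s)) (M r) = qpoch q (q powi - int (M s) * x r / x s) (M r)"
      by simp
  qed
  moreover have "(\<Prod>s=1..n. a s) = q ^ (msize n M + n)"
    by (rule prod_q_powers) (rule a)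
  ultimately show ?thesis
    using num_poly_eq[of n a q x M] a q_nonzero by (simp add: power_mult)
qed

context
  fixes M :: "nat \<Rightarrow> nat" and a :: "nat \<Rightarrow> complex" and \<alpha> :: complex
  assumes M: "M \<in> multi_indices n" and a_eq: "\<And>r. r \<in> {1..n} \<Longrightarrow> a r = q ^ Suc (M r)"
    and denom_qpoch: "\<And>k. qpoch q (\<alpha> * q ^ Suc (msize n M)) k \<noteq> 0"
begin

definition index_box :: "(nat \<Rightarrow> nat) set" where
  "index_box = (\<Pi>\<^sub>E r\<in>{1..n}. {0..M r})"

text \<open>The \<open>k\<close>-dependent part of the coefficient of the value of \<open>f\<close>
  belonging to \<open>m\<close>. The exponents of the a_r are shifted by one, so that m = M belongs
  to the value of \<open>f\<close> on the left-hand side. All of the box is summed over because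
  \<open>numer k m\<close> vanishes unless m \<le> k.\<close>

definition coefficient :: "(nat \<Rightarrow> nat) \<Rightarrow> complex" where
  "coefficient m = (\<Sum>k\<in>index_box. (1 - \<alpha> * q ^ (2 * msize n k)) * qpoch q \<alpha> (msize n k + msize n m) /
     qpoch q (\<alpha> * q ^ Suc (msize n M)) (msize n k) * (outer_term a m k / q ^ (n * msize n k)))"

lemma finite_index_box: "finite index_box"
  unfolding index_box_def by (intro finite_PiE) auto

lemma index_box_subset: "index_box \<subseteq> multi_indices n"
  by (auto simp: index_box_def multi_indices_def PiE_iff)

lemma num_poly_outside_index_box:
  assumes "k \<in> multi_indices n" "k \<notin> index_box"
  shows "num_poly n q x a k = 0"
proof -
  obtain r where "r \<in> {1..n}" "\<not> k r \<le> M r"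
    using assms by (auto simp: index_box_def multi_indices_def PiE_iff)
  then show ?thesis using num_poly_eq_0[of r M k a] a_eq by simp
qed

lemma msize_index_box: "k \<in> index_box \<Longrightarrow> msize n k \<le> msize n M"
  unfolding msize_def index_box_def by (intro sum_mono) (auto simp: PiE_iff)

text \<open>Grouping by |k| leaves a one-variable sum to which \<open>telescoping_sum\<close>
  applies, with K = |M|. It gives (q^|m| - q^|M|) \<open>coefficient m\<close> = 0, and |m| \<noteq>
  |M|.\<close>

lemma coefficient_eq_0:
  assumes m: "m \<in> index_box" "m \<noteq> M"
  shows "coefficient m = 0"
proof -
  define P where "P = msize n M"
  define p where "p = msize n m"
  \<comment> \<open>Dividing by \<open>q ^ (n * N)\<close> removes the common factor
    \<open>q ^ n\<close> from q^(n + N) - q^(|M| + n) and produces the recurrence of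
    \<open>telescoping_sum\<close>.\<close>
  define U where "U N = (\<Sum>k\<in>level n N. outer_term a m k) / q ^ (n * N)" for N
  define c where "c N = (1 - \<alpha> * q ^ (2 * N)) * qpoch q \<alpha> (N + p) / qpoch q (\<alpha> * q ^ Suc P) N" for N
  have U0: "(1 - q ^ p) * U 0 = 0"
    using sum_outer_term_0[of m a] by (simp add: U_def p_def)
  have US: "(q ^ Suc N - q ^ p) * U (Suc N) = (q ^ N - q ^ P) * U N" for N
  proof -
    have "(q ^ Suc N - q ^ p) * U (Suc N) * q ^ (n * Suc N) =
        (q ^ (n + N) - q ^ (P + n)) * (\<Sum>k\<in>level n N. outer_term a m k)"
    proof -
      have "(\<Prod>s=1..n. a s) = q ^ (P + n)" unfolding P_def by (rule prod_q_powers) (rule a_eq)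
      then show ?thesis
        using sum_outer_term_step[of N m a] q_nonzero by (simp add: U_def p_def)
    qed
    also have "(\<Sum>k\<in>level n N. outer_term a m k) = U N * q ^ (n * N)"
      using q_nonzero by (simp add: U_def)
    also have "(q ^ (n + N) - q ^ (P + n)) * (U N * q ^ (n * N)) = (q ^ N - q ^ P) * U N * q ^ (n * Suc N)"
      by (simp add: power_add algebra_simps)
    finally show ?thesis using q_nonzero by simp
  qed
  have "coefficient m = (\<Sum>N\<le>P. \<Sum>k\<in>{k \<in> index_box. msize n k = N}. c (msize n k) * (outer_term a m k / q ^ (n * msize n k)))"
    unfolding coefficient_def c_def P_def p_def
    by (rule sum.group[symmetric]) (use finite_index_box msize_index_box in auto)
  also have "\<dots> = (\<Sum>N\<le>P. c N * U N)"
  proof (rule sum.cong[OF refl])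
    fix N
    have "(\<Sum>k\<in>{k \<in> index_box. msize n k = N}. c (msize n k) * (outer_term a m k / q ^ (n * msize n k))) =
        (\<Sum>k\<in>level n N. c (msize n k) * (outer_term a m k / q ^ (n * msize n k)))"
    \<comment> \<open>Outside the box \<open>num_poly\<close> vanishes, so the full level may be
      summed.\<close>
    proof (rule sum.mono_neutral_left)
      show "{k \<in> index_box. msize n k = N} \<subseteq> level n N"
        using index_box_subset by (auto simp: level_def)
      show "\<forall>k\<in>level n N - {k \<in> index_box. msize n k = N}. c (msize n k) * (outer_term a m k / q ^ (n * msize n k)) = 0"
        using num_poly_outside_index_box by (auto simp: level_def outer_term_def)
    qed (rule finite_level)
    also have "\<dots> = (\<Sum>k\<in>level n N. c N / q ^ (n * N) * outer_term a m k)"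
      by (rule sum.cong) (auto simp: level_def)
    also have "\<dots> = c N * U N"
      unfolding U_def sum_distrib_left[symmetric] by simp
    finally show "(\<Sum>k\<in>{k \<in> index_box. msize n k = N}. c (msize n k) * (outer_term a m k / q ^ (n * msize n k))) = c N * U N" .
  qed
  finally have coeff: "coefficient m = (\<Sum>N\<le>P. c N * U N)" .
  have "(q ^ p - q ^ P) * (\<Sum>N\<le>P. c N * U N) = 0"
    using telescoping_sum[OF U0 US, of \<alpha> P] denom_qpoch by (simp add: c_def P_def)
  \<comment> \<open>Since m \<le> M entrywise, equal sizes would force m = M.\<close>
  moreover have "p \<noteq> P"
  proof
    assume "p = P"
    have le: "\<And>r. r \<in> {1..n} \<Longrightarrow> m r \<le> M r" using m by (auto simp: index_box_def PiE_iff)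
    have "m r = M r" if "r \<in> {1..n}" for r
      using sum_mono_inv[of m "{1..n}" M r] le that \<open>p = P\<close> by (simp add: p_def P_def msize_def)
    then have "m = M"
      using m(1) M unfolding index_box_def multi_indices_def
      by (intro extensionalityI[of m "{1..n}" M]) (auto simp: PiE_iff)
    then show False using m by simp
  qed
  ultimately show ?thesis using q_power_inj[of p P] coeff by auto
qed

text \<open>The box gives k \<le> M and nonvanishing of \<open>numer k M\<close> gives M \<le> k, so
  only k = M contributes. There \<open>num_poly\<close> yields a second factor
  \<open>numer M M\<close>.\<close>

lemma coefficient_diagonal:
  "coefficient M = qpoch q \<alpha> (Suc (2 * msize n M)) / qpoch q (\<alpha> * q ^ Suc (msize n M)) (msize n M) *
     (vandermonde n (node M) * (numer M M)\<^sup>2 / denom M * q ^ (msize n M * msize n M))"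
proof -
  let ?P = "msize n M"
  have MB: "M \<in> index_box" using M by (auto simp: index_box_def multi_indices_def PiE_iff)
  have z: "outer_term a M k = 0" if k: "k \<in> index_box" "k \<noteq> M" for k
  proof -
    have "\<exists>r\<in>{1..n}. k r \<noteq> M r"
      using k M extensionalityI[of k "{1..n}" M] by (auto simp: index_box_def multi_indices_def PiE_iff)
    then obtain r where "r \<in> {1..n}" "k r \<noteq> M r" by blast
    moreover from this have "k r \<le> M r" using k by (auto simp: index_box_def PiE_iff)
    ultimately show ?thesis using numer_eq_0[of r k M] by (simp add: outer_term_def)
  qed
  have np: "num_poly n q x a M = numer M M * q ^ ((?P + n) * ?P)"
    by (rule num_poly_diagonal) (rule a_eq)
  have "coefficient M = (\<Sum>k\<in>{M}. (1 - \<alpha> * q ^ (2 * msize n k)) * qpoch q \<alpha> (msize n k + ?P) /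
     qpoch q (\<alpha> * q ^ Suc ?P) (msize n k) * (outer_term a M k / q ^ (n * msize n k)))"
    unfolding coefficient_def
    by (rule sum.mono_neutral_right) (use MB z in \<open>auto intro: finite_index_box\<close>)
  also have "\<dots> = qpoch q \<alpha> (Suc (2 * ?P)) / qpoch q (\<alpha> * q ^ Suc ?P) ?P * (outer_term a M M / q ^ (n * ?P))"
    by (simp add: qpoch_Suc mult_2 mult_2_right mult.commute)
  also have "outer_term a M M / q ^ (n * ?P) = vandermonde n (node M) * (numer M M)\<^sup>2 / denom M * q ^ (?P * ?P)"
    using q_nonzero by (simp add: outer_term_def np power_add distrib_right power2_eq_square)
  finally show ?thesis .
qed

text \<open>The inner range m \<le> k is enlarged to the box, which does not depend on
  \<open>k\<close>, so that the two sums can be exchanged. The factorials in \<open>\<alpha>\<close>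
  merge into one of length |k| + |m| by \<open>qpoch_add\<close>.\<close>

lemma rhs_term_eq:
  assumes k: "k \<in> index_box"
  shows "rhs_term n q \<alpha> b x f a k =
    (\<Sum>m\<in>index_box. vandermonde_quot n q x m * q ^ (\<Sum>r=1..n. r * m r) / denom m /
        (\<Prod>r=1..n. qpoch q (\<alpha> * b * x r) (m r)) * f (\<lambda>r\<in>{1..n}. \<alpha> * q ^ (1 + m r)) /
        ((1 - \<alpha>) * vandermonde n x) *
      ((1 - \<alpha> * q ^ (2 * msize n k)) * qpoch q \<alpha> (msize n k + msize n m) /
     qpoch q (\<alpha> * q ^ Suc (msize n M)) (msize n k) * (outer_term a m k / q ^ (n * msize n k))))"
proof -
  let ?P = "msize n M"
  let ?g = "\<lambda>m. vandermonde_quot n q x m * (numer k m / denom m) *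
        (qpoch q (\<alpha> * q ^ msize n k) (msize n m) / (\<Prod>r=1..n. qpoch q (\<alpha> * b * x r) (m r))) *
        q ^ (\<Sum>r=1..n. r * m r) * f (\<lambda>r\<in>{1..n}. \<alpha> * q ^ (1 + m r))"
  have inner: "inner_sum n q \<alpha> b x f k = (\<Sum>m\<in>index_box. ?g m)"
  proof -
    have "inner_sum n q \<alpha> b x f k = (\<Sum>m\<in>(\<Pi>\<^sub>E r\<in>{1..n}. {0..k r}). ?g m)"
      unfolding inner_sum_def numer_def denom_def by (simp add: prod_dividef)
    also have "\<dots> = (\<Sum>m\<in>index_box. ?g m)"
    proof (rule sum.mono_neutral_left)
      show "(\<Pi>\<^sub>E r\<in>{1..n}. {0..k r}) \<subseteq> index_box"
        using k unfolding index_box_def by (intro PiE_mono) (auto simp: PiE_iff)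
      show "\<forall>m\<in>index_box - (\<Pi>\<^sub>E r\<in>{1..n}. {0..k r}). ?g m = 0"
      proof
        fix m assume "m \<in> index_box - (\<Pi>\<^sub>E r\<in>{1..n}. {0..k r})"
        then obtain r where "r \<in> {1..n}" "k r < m r"
          by (auto simp: index_box_def PiE_iff)
        then show "?g m = 0" using numer_eq_0 by simp
      qed
    qed (rule finite_index_box)
    finally show ?thesis .
  qed
  have pw: "q powi ((\<Sum>r=1..n. (int r - 1) * int (k r)) - int n * int (msize n k)) =
      q ^ (\<Sum>r=1..n. (r - 1) * k r) / q ^ (n * msize n k)"
  proof -
    have "(\<Sum>r=1..n. (int r - 1) * int (k r)) = int (\<Sum>r=1..n. (r - 1) * k r)"
      unfolding of_nat_sum by (rule sum.cong) (auto simp: of_nat_diff)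
    moreover have "q powi (int i - int j) = q ^ i / q ^ j" for i j
      using q_nonzero by (simp add: power_int_diff)
    ultimately show ?thesis
      by (simp only: of_nat_mult[symmetric])
  qed
  have ar: "\<alpha> * (\<Prod>r=1..n. a r) * q powi (1 - int n) = \<alpha> * q ^ Suc ?P"
    by (rule shifted_prod_q_powers) (rule a_eq)
  have V: "vandermonde_quot n q x k * q ^ (\<Sum>r=1..n. (r - 1) * k r) = vandermonde n (node k) / vandermonde n x"
    using vandermonde_quot_eq[of q n x k] q_nonzero x_nonzero by (simp add: node_def[abs_def])
  have "rhs_term n q \<alpha> b x f a k = (vandermonde_quot n q x k * q ^ (\<Sum>r=1..n. (r - 1) * k r)) *
     (num_poly n q x a k / denom k) *
     ((1 - \<alpha> * q ^ (2 * msize n k)) * qpoch q \<alpha> (msize n k) /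
      ((1 - \<alpha>) * qpoch q (\<alpha> * q ^ Suc ?P) (msize n k))) / q ^ (n * msize n k) * (\<Sum>m\<in>index_box. ?g m)"
    unfolding rhs_term_def ar pw inner denom_def by simp
  also have "\<dots> = (\<Sum>m\<in>index_box. vandermonde_quot n q x m * q ^ (\<Sum>r=1..n. r * m r) / denom m /
        (\<Prod>r=1..n. qpoch q (\<alpha> * b * x r) (m r)) * f (\<lambda>r\<in>{1..n}. \<alpha> * q ^ (1 + m r)) /
        ((1 - \<alpha>) * vandermonde n x) *
      ((1 - \<alpha> * q ^ (2 * msize n k)) * qpoch q \<alpha> (msize n k + msize n m) /
     qpoch q (\<alpha> * q ^ Suc (msize n M)) (msize n k) * (outer_term a m k / q ^ (n * msize n k))))"
    unfolding V sum_distrib_left qpoch_add outer_term_def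
    by (rule sum.cong) (simp_all add: mult_ac)
  finally show ?thesis .
qed

lemma terminating_sum:
  assumes q: "norm q < 1" and \<alpha>: "\<alpha> \<noteq> 1"
    and inf1: "qpoch_inf q (\<alpha> * q ^ Suc (msize n M)) \<noteq> 0"
    and inf2: "\<And>r. r \<in> {1..n} \<Longrightarrow> qpoch_inf q (\<alpha> * b * x r) \<noteq> 0"
  shows "(rhs_term n q \<alpha> b x f a has_sum lhs n q \<alpha> b x f a) (multi_indices n)"
proof -
  let ?P = "msize n M"
  let ?B = "\<Prod>r=1..n. qpoch q (\<alpha> * b * x r) (M r)"
  let ?c = "\<lambda>m. vandermonde_quot n q x m * q ^ (\<Sum>r=1..n. r * m r) / denom m /
        (\<Prod>r=1..n. qpoch q (\<alpha> * b * x r) (m r)) * f (\<lambda>r\<in>{1..n}. \<alpha> * q ^ (1 + m r)) /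
        ((1 - \<alpha>) * vandermonde n x)"
  have MB: "M \<in> index_box" using M by (auto simp: index_box_def multi_indices_def PiE_iff)
  have Vx: "vandermonde n x \<noteq> 0"
    using vandermonde_nonzero[OF inj_on_node[of "\<lambda>_. 0"]] by (simp add: node_def[abs_def])
  have "(\<Sum>k\<in>index_box. rhs_term n q \<alpha> b x f a k) = (\<Sum>m\<in>index_box. ?c m * coefficient m)"
    unfolding coefficient_def sum_distrib_left
    by (subst sum.swap) (rule sum.cong[OF refl rhs_term_eq])
  also have "\<dots> = (\<Sum>m\<in>{M}. ?c m * coefficient m)"
    by (rule sum.mono_neutral_right) (use MB coefficient_eq_0 in \<open>auto intro: finite_index_box\<close>)
  also have "\<dots> = ?c M * coefficient M" by simp
  also have "\<dots> = f (\<lambda>r\<in>{1..n}. \<alpha> * q ^ (1 + M r)) * qpoch q (\<alpha> * q) ?P / ?B"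
  proof -
    \<comment> \<open>The weight r instead of r - 1 contributes an extra q^|M|, which completes
      q^(|M||M|) to the exponent in \<open>diagonal_square\<close>.\<close>
    have e: "(\<Sum>r=1..n. r * M r) = (\<Sum>r=1..n. (r - 1) * M r) + ?P"
      unfolding msize_def sum.distrib[symmetric]
    proof (rule sum.cong[OF refl])
      fix r assume "r \<in> {1..n}"
      then show "r * M r = (r - 1) * M r + M r" by (cases r) auto
    qed
    have VV: "vandermonde_quot n q x M * q ^ (\<Sum>r=1..n. (r - 1) * M r) = vandermonde n (node M) / vandermonde n x"
      using vandermonde_quot_eq[of q n x M] q_nonzero x_nonzero by (simp add: node_def[abs_def])
    have V: "vandermonde_quot n q x M * q ^ (\<Sum>r=1..n. r * M r) = vandermonde n (node M) / vandermonde n x * q ^ ?P"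
      unfolding e power_add mult.assoc[symmetric] VV ..
    have A: "qpoch q \<alpha> (Suc (2 * ?P)) / qpoch q (\<alpha> * q ^ Suc ?P) ?P = (1 - \<alpha>) * qpoch q (\<alpha> * q) ?P"
    proof -
      have "qpoch q \<alpha> (Suc (2 * ?P)) = (1 - \<alpha>) * (qpoch q (\<alpha> * q) ?P * qpoch q (\<alpha> * q ^ Suc ?P) ?P)"
        using qpoch_add[of q \<alpha> 1 "?P + ?P"] qpoch_add[of q "\<alpha> * q" ?P ?P]
        by (simp add: qpoch_Suc[of q \<alpha> 0] mult_2 mult_2_right mult_ac)
      then show ?thesis using denom_qpoch[of ?P] by simp
    qed
    have D: "(vandermonde n (node M) * numer M M / denom M)\<^sup>2 * q ^ (?P * ?P + ?P) = (vandermonde n x)\<^sup>2"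
      using diagonal_square[of M] by (simp add: add.commute)
    let ?F = "f (\<lambda>r\<in>{1..n}. \<alpha> * q ^ (1 + M r))"
    \<comment> \<open>One copy each of the Vandermonde product and of 1 / \<open>denom M\<close>
      comes from the inner sum, the other from \<open>coefficient M\<close>, so a full square
      appears.\<close>
    have "?c M * coefficient M = ?F * qpoch q (\<alpha> * q) ?P / ?B *
       (((vandermonde n (node M) * numer M M / denom M)\<^sup>2 * q ^ (?P * ?P + ?P)) / (vandermonde n x)\<^sup>2)"
      unfolding coefficient_diagonal V A using \<alpha> Vx
      by (simp add: power_add power2_eq_square mult_ac)
    then show ?thesis unfolding D using Vx by simp
  qed
  also have "\<dots> = lhs n q \<alpha> b x f a"
  proof -
    have F: "(\<lambda>r\<in>{1..n}. \<alpha> * a r) = (\<lambda>r\<in>{1..n}. \<alpha> * q ^ (1 + M r))"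
      using a_eq by (intro restrict_ext) simp
    have ar: "\<alpha> * (\<Prod>r=1..n. a r) * q powi (1 - int n) = \<alpha> * q ^ Suc ?P"
      by (rule shifted_prod_q_powers) (rule a_eq)
    \<comment> \<open>As a_r / q = q^M_r, each quotient of infinite products reduces to a finite
      one.\<close>
    have B: "(\<Prod>r=1..n. qpoch_inf q (\<alpha> * a r * b * x r / q) / qpoch_inf q (\<alpha> * b * x r)) = 1 / ?B"
    proof -
      have "(\<Prod>r=1..n. qpoch_inf q (\<alpha> * a r * b * x r / q) / qpoch_inf q (\<alpha> * b * x r)) =
          (\<Prod>r=1..n. 1 / qpoch q (\<alpha> * b * x r) (M r))"
      proof (rule prod.cong[OF refl])
        fix r assume r: "r \<in> {1..n}"
        have "\<alpha> * a r * b * x r / q = \<alpha> * b * x r * q ^ M r"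
          using a_eq[OF r] q_nonzero by simp
        then show "qpoch_inf q (\<alpha> * a r * b * x r / q) / qpoch_inf q (\<alpha> * b * x r) = 1 / qpoch q (\<alpha> * b * x r) (M r)"
          using inf2[OF r] qpoch_inf_split[OF q, of "\<alpha> * b * x r" "M r"] by simp
      qed
      then show ?thesis by (simp add: prod_dividef)
    qed
    show ?thesis
      using qpoch_inf_split[OF q, of "\<alpha> * q" ?P] inf1
      unfolding lhs_def F ar B by (simp add: mult_ac)
  qed
  finally have "(\<Sum>k\<in>index_box. rhs_term n q \<alpha> b x f a k) = lhs n q \<alpha> b x f a" .
  then have "(rhs_term n q \<alpha> b x f a has_sum lhs n q \<alpha> b x f a) index_box"
    using has_sum_finite[OF finite_index_box, of "rhs_term n q \<alpha> b x f a"] by simp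
  moreover have "rhs_term n q \<alpha> b x f a k = 0" if "k \<in> multi_indices n - index_box" for k
    using num_poly_outside_index_box that by (simp add: rhs_term_def)
  ultimately show ?thesis
    using index_box_subset by (subst has_sum_cong_neutral[of "index_box" "multi_indices n"]) auto
qed

end

end

section \<open>The identity theorem on polydiscs\<close>

text \<open>On a line parallel to the \<open>r\<close>-th axis through the centre of a local
  expansion, only the monomials in the \<open>r\<close>-th variable survive, which leaves a power
  series in one variable.\<close>

lemma multi_analytic_on_slice_holomorphic:
  fixes \<rho> :: "nat \<Rightarrow> real"
  assumes g: "multi_analytic_on n g (polydisc n (\<lambda>_. 0) \<rho>)"
    and p: "p \<in> polydisc n (\<lambda>_. 0) \<rho>" and r: "r \<in> {1..n}"
  shows "(\<lambda>w. g (p(r := w))) holomorphic_on ball 0 (\<rho> r)"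
proof (rule analytic_imp_holomorphic, unfold analytic_on_def, intro ballI)
  fix w0 :: complex
  assume "w0 \<in> ball 0 (\<rho> r)"
  define p' where "p' = p(r := w0)"
  have "p' \<in> polydisc n (\<lambda>_. 0) \<rho>"
    using p r \<open>w0 \<in> ball 0 (\<rho> r)\<close> unfolding p'_def polydisc_def by (auto simp: PiE_iff extensional_def)
  then obtain c \<epsilon> where \<epsilon>: "\<epsilon> > 0"
    and c: "\<And>z. z \<in> polydisc n p' (\<lambda>_. \<epsilon>) \<Longrightarrow>
        ((\<lambda>\<nu>. c \<nu> * (\<Prod>r=1..n. (z r - p' r) ^ \<nu> r)) has_sum g z) (multi_indices n)"
    using g unfolding multi_analytic_on_def by meson
  \<comment> \<open>\<open>e j\<close> is the exponent vector with entry j at \<open>r\<close> and 0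
    elsewhere in the index range.\<close>
  define e where "e j = (\<lambda>s\<in>{1..n}. if s = r then j else 0)" for j :: nat
  have inj: "inj e"
    using r unfolding e_def by (auto simp: inj_def fun_eq_iff restrict_def split: if_splits)
  have e_mi: "range e \<subseteq> multi_indices n" by (auto simp: e_def multi_indices_def)
  have "(\<lambda>w. g (p(r := w))) holomorphic_on ball w0 \<epsilon>"
  proof (rule power_series_holomorphic)
    fix w assume w: "w \<in> ball w0 \<epsilon>"
    let ?z = "p(r := w)"
    let ?F = "\<lambda>\<nu>. c \<nu> * (\<Prod>s=1..n. (?z s - p' s) ^ \<nu> s)"
    have "?z \<in> polydisc n p' (\<lambda>_. \<epsilon>)"
      using p r w \<epsilon> unfolding p'_def polydisc_def by (auto simp: PiE_iff extensional_def)
    then have "(?F has_sum g ?z) (multi_indices n)" by (rule c)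
    moreover have "?F \<nu> = 0" if "\<nu> \<in> multi_indices n - range e" for \<nu>
    proof -
      have "\<exists>s\<in>{1..n}. s \<noteq> r \<and> \<nu> s \<noteq> 0"
      proof (rule ccontr)
        assume "\<not> ?thesis"
        then have "\<nu> = e (\<nu> r)"
          using that r by (intro extensionalityI[of \<nu> "{1..n}"]) (auto simp: e_def multi_indices_def PiE_iff)
        then show False using that by blast
      qed
      then obtain s where s: "s \<in> {1..n}" "s \<noteq> r" "\<nu> s \<noteq> 0" by blast
      then have "(?z s - p' s) ^ \<nu> s = 0" by (simp add: p'_def)
      then have "(\<Prod>s=1..n. (?z s - p' s) ^ \<nu> s) = 0"
        using s(1) by (intro prod_zero[OF finite_atLeastAtMost]) blast
      then show ?thesis by simp
    qed
    ultimately have "(?F has_sum g ?z) (range e)"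
      using e_mi by (subst has_sum_cong_neutral[of "multi_indices n" "range e" ?F ?F]) auto
    then have "((?F \<circ> e) has_sum g ?z) UNIV"
      using has_sum_reindex[OF inj] by blast
    moreover have "?F \<circ> e = (\<lambda>j. c (e j) * (w - w0) ^ j)"
    proof
      fix j
      have "(\<Prod>s=1..n. (?z s - p' s) ^ e j s) = (w - w0) ^ j * (\<Prod>s\<in>{1..n} - {r}. (?z s - p' s) ^ e j s)"
        using r by (subst prod.remove[of _ r]) (auto simp: e_def p'_def)
      also have "(\<Prod>s\<in>{1..n} - {r}. (?z s - p' s) ^ e j s) = 1"
        by (rule prod.neutral) (auto simp: e_def)
      finally show "(?F \<circ> e) j = c (e j) * (w - w0) ^ j" by simp
    qed
    ultimately have "((\<lambda>j. c (e j) * (w - w0) ^ j) has_sum g ?z) UNIV" by simp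
    then show "(\<lambda>j. c (e j) * (w - w0) ^ j) sums g ?z" by (rule has_sum_imp_sums)
  qed
  then show "\<exists>\<epsilon>>0. (\<lambda>w. g (p(r := w))) holomorphic_on ball w0 \<epsilon>" using \<epsilon> by blast
qed

text \<open>Induction on \<open>j\<close>: \<open>g\<close> vanishes wherever the coordinates beyond
  \<open>j\<close> lie in their sets \<open>Z r\<close>. The induction step frees coordinate
  \<open>Suc j\<close> by the one-variable identity theorem, the other coordinates being
  fixed.\<close>

lemma polydisc_identity:
  fixes \<rho> :: "nat \<Rightarrow> real" and Z :: "nat \<Rightarrow> complex set"
  assumes slice: "\<And>p r. p \<in> polydisc n (\<lambda>_. 0) \<rho> \<Longrightarrow> r \<in> {1..n} \<Longrightarrow>
      (\<lambda>w. g (p(r := w))) holomorphic_on ball 0 (\<rho> r)"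
    and Z: "\<And>r. r \<in> {1..n} \<Longrightarrow> 0 islimpt Z r \<inter> ball 0 (\<rho> r)"
    and zero: "\<And>p. p \<in> polydisc n (\<lambda>_. 0) \<rho> \<Longrightarrow> (\<And>r. r \<in> {1..n} \<Longrightarrow> p r \<in> Z r) \<Longrightarrow> g p = 0"
    and p: "p \<in> polydisc n (\<lambda>_. 0) \<rho>"
  shows "g p = 0"
proof -
  have "\<forall>p \<in> polydisc n (\<lambda>_. 0) \<rho>. (\<forall>r\<in>{j<..n}. p r \<in> Z r) \<longrightarrow> g p = 0" for j
  proof (induction j)
    case 0
    then show ?case using zero by auto
  next
    case (Suc j)
    show ?case
    proof (intro ballI impI)
      fix p assume p: "p \<in> polydisc n (\<lambda>_. 0) \<rho>" and pZ: "\<forall>r\<in>{Suc j<..n}. p r \<in> Z r"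
      show "g p = 0"
      proof (cases "Suc j \<le> n")
        case False
        then show ?thesis using Suc p by auto
      next
        case True
        let ?r = "Suc j"
        have r: "?r \<in> {1..n}" using True by simp
        have pr: "p ?r \<in> ball 0 (\<rho> ?r)" using p r unfolding polydisc_def PiE_iff by blast
        then have "0 \<in> ball 0 (\<rho> ?r)" by (auto simp: le_less_trans[OF norm_ge_zero])
        have "g (p(?r := w)) = 0" if "w \<in> Z ?r \<inter> ball 0 (\<rho> ?r)" for w
        proof -
          have "p(?r := w) \<in> polydisc n (\<lambda>_. 0) \<rho>"
            using p r that unfolding polydisc_def by (auto simp: PiE_iff extensional_def)
          moreover have "\<forall>s\<in>{j<..n}. (p(?r := w)) s \<in> Z s"
            using pZ that by (auto simp: Suc_lessI)
          ultimately show ?thesis using Suc by blast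
        qed
        then have "g (p(?r := p ?r)) = 0"
          using analytic_continuation[OF slice[OF p r] open_ball _ _ \<open>0 \<in> ball 0 (\<rho> ?r)\<close> Z[OF r] _ pr] by auto
        then show ?thesis by simp
      qed
    qed
  qed
  from this[of n] show ?thesis using p by auto
qed

lemma zero_islimpt_powers:
  fixes q :: complex
  assumes "q \<noteq> 0" "norm q < 1" "\<rho> > 0"
  shows "0 islimpt {q ^ N |N. N \<ge> N0} \<inter> ball 0 \<rho>"
  unfolding islimpt_approachable
proof (intro allI impI)
  fix e :: real assume "e > 0"
  have "(\<lambda>N. norm q ^ N) \<longlonglongrightarrow> 0" using assms by (intro LIMSEQ_realpow_zero) auto
  then have "eventually (\<lambda>N. norm q ^ N < min e \<rho>) sequentially"
    using \<open>e > 0\<close> \<open>\<rho> > 0\<close> by (intro order_tendstoD) auto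
  then have "eventually (\<lambda>N. norm q ^ N < min e \<rho> \<and> N \<ge> N0) sequentially"
    using eventually_ge_at_top[of N0] by eventually_elim simp
  then obtain N where "norm q ^ N < min e \<rho>" "N \<ge> N0"
    unfolding eventually_sequentially by blast
  then show "\<exists>x'\<in>{q ^ N |N. N \<ge> N0} \<inter> ball 0 \<rho>. x' \<noteq> 0 \<and> dist x' 0 < e"
    using assms by (intro bexI[of _ "q ^ N"]) (auto simp: norm_power)
qed

section \<open>The transformation formula\<close>

text \<open>Points of a polydisc are \<open>undefined\<close> outside the index range, whereas the
  parameter \<open>a\<close> of the theorem is arbitrary there; this and the next lemma pass between
  the two.\<close>

lemma rhs_term_restrict: "rhs_term n q \<alpha> b x f (restrict a {1..n}) = rhs_term n q \<alpha> b x f a"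
proof -
  have "num_poly n q x (restrict a {1..n}) k = num_poly n q x a k" for k
    unfolding num_poly_def by (intro prod.cong) auto
  moreover have "(\<Prod>r=1..n. restrict a {1..n} r) = (\<Prod>r=1..n. a r)"
    by (rule prod.cong) auto
  ultimately show ?thesis unfolding rhs_term_def by (intro ext) (simp only:)
qed

lemma lhs_restrict: "lhs n q \<alpha> b x f (restrict a {1..n}) = lhs n q \<alpha> b x f a"
proof -
  have "(\<lambda>r\<in>{1..n}. \<alpha> * restrict a {1..n} r) = (\<lambda>r\<in>{1..n}. \<alpha> * a r)"
    by (rule restrict_ext) simp
  moreover have "(\<Prod>r=1..n. restrict a {1..n} r) = (\<Prod>r=1..n. a r)"
    by (rule prod.cong) auto
  moreover have "(\<Prod>r=1..n. qpoch_inf q (\<alpha> * restrict a {1..n} r * b * x r / q) / qpoch_inf q (\<alpha> * b * x r)) =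
      (\<Prod>r=1..n. qpoch_inf q (\<alpha> * a r * b * x r / q) / qpoch_inf q (\<alpha> * b * x r))"
    by (rule prod.cong) auto
  ultimately show ?thesis unfolding lhs_def by (simp only:)
qed

theorem theorem1p6:
  fixes q \<alpha> b :: complex and n :: nat and x a :: "nat \<Rightarrow> complex"
    and f :: "(nat \<Rightarrow> complex) \<Rightarrow> complex"
  assumes "n \<ge> 1" and "0 < norm q" and "norm q < 1"
    and "\<alpha> \<noteq> 1"
    and "\<And>r. r \<in> {1..n} \<Longrightarrow> x r \<noteq> 0"
    and "\<And>r s. r \<in> {1..n} \<Longrightarrow> s \<in> {1..n} \<Longrightarrow> r < s \<Longrightarrow> 1 - x r / x s \<noteq> 0"
    and "\<And>r s k. r \<in> {1..n} \<Longrightarrow> s \<in> {1..n} \<Longrightarrow> qpoch q (q * x r / x s) k \<noteq> 0"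
    and "\<And>r. r \<in> {1..n} \<Longrightarrow> qpoch_inf q (\<alpha> * b * x r) \<noteq> 0"
    and "\<And>r k. r \<in> {1..n} \<Longrightarrow> qpoch q (\<alpha> * b * x r) k \<noteq> 0"
    and "qpoch_inf q (\<alpha> * (\<Prod>r=1..n. a r) * q powi (1 - int n)) \<noteq> 0"
    and "\<And>k. qpoch q (\<alpha> * (\<Prod>r=1..n. a r) * q powi (1 - int n)) k \<noteq> 0"
    and "(\<exists>\<rho>. (\<forall>r\<in>{1..n}. \<rho> r > 0 \<and> norm (a r) < \<rho> r) \<and>
            multi_analytic_on n (\<lambda>a'. lhs n q \<alpha> b x f a') (polydisc n (\<lambda>_. 0) \<rho>) \<and>
            multi_analytic_on n (\<lambda>a'. \<Sum>\<^sub>\<infinity>k\<in>multi_indices n. rhs_term n q \<alpha> b x f a' k)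
              (polydisc n (\<lambda>_. 0) \<rho>) \<and>
            (\<forall>a'\<in>polydisc n (\<lambda>_. 0) \<rho>.
               (\<lambda>k. norm (rhs_term n q \<alpha> b x f a' k)) summable_on multi_indices n))
         \<or> (\<exists>N :: nat \<Rightarrow> nat. \<forall>r\<in>{1..n}. N r > 0 \<and> a r = q ^ N r)"
  shows "((\<lambda>k. rhs_term n q \<alpha> b x f a k) has_sum lhs n q \<alpha> b x f a) (multi_indices n)"
proof -
  interpret generic_nodes n q x
    by unfold_locales (fact assms | use assms(2) in simp)+
  note q = q_nonzero
  have terminating: "(rhs_term n q \<alpha> b x f a' has_sum lhs n q \<alpha> b x f a') (multi_indices n)"
    if a': "\<And>r. r \<in> {1..n} \<Longrightarrow> a' r = q ^ N r" "\<And>r. r \<in> {1..n} \<Longrightarrow> N r > 0"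
      and inf: "qpoch_inf q (\<alpha> * (\<Prod>r=1..n. a' r) * q powi (1 - int n)) \<noteq> 0"
      and fin: "\<And>k. qpoch q (\<alpha> * (\<Prod>r=1..n. a' r) * q powi (1 - int n)) k \<noteq> 0" for a' N
  proof -
    \<comment> \<open>Restriction makes \<open>M\<close> a multi-index; the subtraction is exact
      because N_r > 0.\<close>
    define M where "M = (\<lambda>r\<in>{1..n}. N r - 1)"
    have M: "M \<in> multi_indices n" by (auto simp: M_def multi_indices_def)
    have a'_eq: "a' r = q ^ Suc (M r)" if "r \<in> {1..n}" for r
      using a'[OF that] that by (simp add: M_def del: power_Suc)
    have prod: "\<alpha> * (\<Prod>r=1..n. a' r) * q powi (1 - int n) = \<alpha> * q ^ Suc (msize n M)"
      by (rule shifted_prod_q_powers) (rule a'_eq)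
    show ?thesis
      by (rule terminating_sum[OF M a'_eq]) (use fin inf assms(3,4,8) in \<open>simp_all only: prod not_False_eq_True\<close>)
  qed
  from assms(12) show ?thesis
  proof
    assume "\<exists>N :: nat \<Rightarrow> nat. \<forall>r\<in>{1..n}. N r > 0 \<and> a r = q ^ N r"
    then obtain N where "\<forall>r\<in>{1..n}. N r > 0 \<and> a r = q ^ N r" ..
    then show ?thesis using terminating[of a N] assms(10,11) by blast
  next
    assume "\<exists>\<rho>. (\<forall>r\<in>{1..n}. \<rho> r > 0 \<and> norm (a r) < \<rho> r) \<and>
            multi_analytic_on n (\<lambda>a'. lhs n q \<alpha> b x f a') (polydisc n (\<lambda>_. 0) \<rho>) \<and>
            multi_analytic_on n (\<lambda>a'. \<Sum>\<^sub>\<infinity>k\<in>multi_indices n. rhs_term n q \<alpha> b x f a' k)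
              (polydisc n (\<lambda>_. 0) \<rho>) \<and>
            (\<forall>a'\<in>polydisc n (\<lambda>_. 0) \<rho>.
               (\<lambda>k. norm (rhs_term n q \<alpha> b x f a' k)) summable_on multi_indices n)"
    then obtain \<rho> where *: "\<forall>r\<in>{1..n}. \<rho> r > 0 \<and> norm (a r) < \<rho> r"
      and L: "multi_analytic_on n (lhs n q \<alpha> b x f) (polydisc n (\<lambda>_. 0) \<rho>)"
      and R: "multi_analytic_on n (\<lambda>a'. \<Sum>\<^sub>\<infinity>k\<in>multi_indices n. rhs_term n q \<alpha> b x f a' k) (polydisc n (\<lambda>_. 0) \<rho>)"
      and S: "\<forall>a'\<in>polydisc n (\<lambda>_. 0) \<rho>. (\<lambda>k. norm (rhs_term n q \<alpha> b x f a' k)) summable_on multi_indices n"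
      by (elim exE conjE)
    have \<rho>: "\<rho> r > 0" "norm (a r) < \<rho> r" if "r \<in> {1..n}" for r
      using * that by simp_all
    have a: "restrict a {1..n} \<in> polydisc n (\<lambda>_. 0) \<rho>"
      using \<rho>(2) by (simp add: polydisc_def PiE_iff)
    \<comment> \<open>The nonvanishing assumptions on the denominators depending on \<open>a\<close>
      concern the given point only. At the comparison points they follow from |\<alpha> q^N| < 1 for
      all N \<ge> \<open>N0\<close>.\<close>
    have "(\<lambda>N. norm \<alpha> * norm q ^ N) \<longlonglongrightarrow> norm \<alpha> * 0"
      using assms(3) by (intro tendsto_intros LIMSEQ_realpow_zero) auto
    then have "eventually (\<lambda>N. norm \<alpha> * norm q ^ N < 1) sequentially"
      by (intro order_tendstoD) auto
    then obtain N0 where N0: "\<And>N. N \<ge> N0 \<Longrightarrow> norm \<alpha> * norm q ^ N < 1"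
      unfolding eventually_sequentially by blast
    define D where "D a' = lhs n q \<alpha> b x f a' - (\<Sum>\<^sub>\<infinity>k\<in>multi_indices n. rhs_term n q \<alpha> b x f a' k)" for a'
    have "D (restrict a {1..n}) = 0"
    \<comment> \<open>Exponents start at \<open>Suc N0\<close>, so that M_r = N_r - 1 is still at
      least \<open>N0\<close>; a single coordinate then gives |M| + 1 \<ge>
      \<open>N0\<close>.\<close>
    proof (rule polydisc_identity[where g = D and Z = "\<lambda>_. {q ^ N |N. N \<ge> Suc N0}"])
      fix p r assume "p \<in> polydisc n (\<lambda>_. 0) \<rho>" "r \<in> {1..n}"
      then show "(\<lambda>w. D (p(r := w))) holomorphic_on ball 0 (\<rho> r)"
        unfolding D_def
        by (intro holomorphic_on_diff multi_analytic_on_slice_holomorphic[OF L] multi_analytic_on_slice_holomorphic[OF R])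
    next
      fix r assume "r \<in> {1..n}"
      then show "0 islimpt {q ^ N |N. N \<ge> Suc N0} \<inter> ball 0 (\<rho> r)"
        by (intro zero_islimpt_powers q assms(3) \<rho>(1))
    next
      fix p assume p: "\<And>r. r \<in> {1..n} \<Longrightarrow> p r \<in> {q ^ N |N. N \<ge> Suc N0}"
      then have "\<forall>r\<in>{1..n}. \<exists>N. p r = q ^ N \<and> N \<ge> Suc N0" by blast
      then obtain N where N: "\<And>r. r \<in> {1..n} \<Longrightarrow> p r = q ^ N r" "\<And>r. r \<in> {1..n} \<Longrightarrow> N r \<ge> Suc N0"
        unfolding bchoice_iff by blast
      define M where "M r = N r - 1" for r
      have M: "p r = q ^ Suc (M r)" "M r \<ge> N0" if "r \<in> {1..n}" for r
        using N[OF that] by (auto simp: M_def simp del: power_Suc)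
      let ?z = "\<alpha> * (\<Prod>r=1..n. p r) * q powi (1 - int n)"
      have "?z = \<alpha> * q ^ Suc (msize n M)"
        by (rule shifted_prod_q_powers) (rule M(1))
      moreover have "N0 \<le> Suc (msize n M)"
      proof -
        have "M 1 \<le> msize n M" unfolding msize_def using assms(1) by (intro member_le_sum) auto
        then show ?thesis using M(2)[of 1] assms(1) by simp
      qed
      ultimately have "norm ?z < 1"
        using N0 by (simp only: norm_mult norm_power)
      then have "(rhs_term n q \<alpha> b x f p has_sum lhs n q \<alpha> b x f p) (multi_indices n)"
      proof (intro terminating[of p N])
        show "p r = q ^ N r" "N r > 0" if "r \<in> {1..n}" for r
          using N[OF that] by simp_all
      qed (rule qpoch_small_nonzero[OF assms(3)], assumption)+
      then have "(\<Sum>\<^sub>\<infinity>k\<in>multi_indices n. rhs_term n q \<alpha> b x f p k) = lhs n q \<alpha> b x f p"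
        by (rule infsumI)
      then show "D p = 0" by (simp only: D_def diff_self)
    next
      show "restrict a {1..n} \<in> polydisc n (\<lambda>_. 0) \<rho>" by (rule a)
    qed
    then have "lhs n q \<alpha> b x f a = (\<Sum>\<^sub>\<infinity>k\<in>multi_indices n. rhs_term n q \<alpha> b x f a k)"
      unfolding D_def lhs_restrict rhs_term_restrict by simp
    \<comment> \<open>Equality with the infinite sum yields \<open>has_sum\<close> only together
      with summability, which absolute convergence at \<open>a\<close> provides.\<close>
    moreover have "rhs_term n q \<alpha> b x f a summable_on multi_indices n"
      using bspec[OF S a] unfolding rhs_term_restrict by (rule abs_summable_summable)
    ultimately show ?thesis by (simp add: has_sum_infsum)
  qed
qed

end
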